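(* Let $n\geq 1$ be an integer, let $R_n$ be the pyrene chain and $T_n$ the triphenylene chain, each with $4n$ hexagons, and let $\tau(\cdot)$ denote the number of spanning trees. Then $$\tau(R_n)=\frac{240+47\sqrt{30}}{480}(528+96\sqrt{30})^{n}+\frac{240-47\sqrt{30}}{480}(528-96\sqrt{30})^{n},$$ \begin{align*} \tau(T_n)=&\frac{1329265+1223\sqrt{1329265}}{2658530}\left(\frac{1153+\sqrt{1329265}}{2}\right)^{n}\\ &+\frac{1329265-1223\sqrt{1329265}}{2658530}\left(\frac{1153-\sqrt{1329265}}{2}\right)^{n}. \end{align*}
   Context: A benzenoid system is a finite connected plane graph without cut vertices in which every interior face is bounded by a regular hexagon of side length $1$; it is catacondensed if no three hexagons share a common vertex. Two hexagons are adjacent if they share an edge. The pyrene chain $R_n$ is the benzenoid system with $4n$ hexagons $u_i,w_i,a_i,b_i$ ($1\le i\le n$) arranged as follows: $u_1,w_1,u_2,w_2,\dots,u_n,w_n$ form a straight linear row, in this order, consecutive ones sharing an edge; for each $i$, $a_i$ is the hexagon above the row adjacent to both $u_i$ and $w_i$, and $b_i$ is the hexagon below the row adjacent to both $u_i$ and $w_i$. The adjacent pairs are exactly $u_iw_i,\ u_ia_i,\ u_ib_i,\ w_ia_i,\ w_ib_i$ ($1\le i\le n$) and $w_iu_{i+1}$ ($1\le i\le n-1$). Equivalently, the planar dual of $R_n$ has vertices $u_i,w_i,a_i,b_i$ and $v$ (the outer face), one edge for each adjacent pair listed, and edges to $v$ with multiplicity $4$ from each $a_i$ and $b_i$, and multiplicity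 $2$ from each $u_i$ and $w_i$, except that $u_1$ and $w_n$ are joined to $v$ with multiplicity $3$. The triphenylene chain $T_n$ is a catacondensed benzenoid system with $4n$ hexagons $c_i,u_i,w_i,b_i$ ($1\le i\le n$), formed by $n$ triphenylene units (unit $i$ being a central hexagon $c_i$ with three pairwise non-adjacent hexagons $u_i,w_i,b_i$ each adjacent to $c_i$), where consecutive units are fused by letting $w_i$ and $u_{i+1}$ share an edge. The adjacent pairs are exactly $c_iu_i,\ c_iw_i,\ c_ib_i$ ($1\le i\le n$) and $w_iu_{i+1}$ ($1\le i\le n-1$). Only the planar dual of $T_n$ is relevant: it has vertices $c_i,u_i,w_i,b_i$ and $v$ (the outer face), one edge for each adjacent pair listed, and edges to $v$ with multiplicity $3$ from each $c_i$, $5$ from each $b_i$, and $4$ from each $u_i$ and $w_i$, except that $u_1$ and $w_n$ are joined to $v$ with multiplicity $5$. *)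

theory Defs
  imports Complex_Main
begin

section \<open>Spanning trees of simple graphs\<close>

text \<open>An undirected simple graph is given by its vertex set and its set of two-element edges.\<close>

definition graph_connected :: "'a set \<Rightarrow> 'a set set \<Rightarrow> bool" where
  "graph_connected V E \<longleftrightarrow>
     V \<noteq> {} \<and> (\<forall>x\<in>V. \<forall>y\<in>V. (x, y) \<in> {(a, b). a \<noteq> b \<and> {a, b} \<in> E}\<^sup>*)"

definition graph_cycle :: "'a set set \<Rightarrow> 'a list \<Rightarrow> bool" where
  "graph_cycle E p \<longleftrightarrow> 3 \<le> length p \<and> distinct p \<and>
     (\<forall>i<length p. {p ! i, p ! (Suc i mod length p)} \<in> E)"

definition spanning_trees :: "'a set \<Rightarrow> 'a set set \<Rightarrow> 'a set set set" where
  "spanning_trees V E = {F. F \<subseteq> E \<and> graph_connected V F \<and> (\<nexists>p. graph_cycle F p)}"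

definition no_cut_vertex :: "'a set \<Rightarrow> 'a set set \<Rightarrow> bool" where
  "no_cut_vertex V E \<longleftrightarrow> (\<forall>v\<in>V. graph_connected (V - {v}) {e \<in> E. v \<notin> e})"


section \<open>Benzenoid systems\<close>

text \<open>The pair \<open>(x, y)\<close> stands for the point $x + y\,e^{i\pi/3}$ of the plane. A cell \<open>(q, r)\<close> is the
  regular hexagon of side length 1 of the honeycomb tiling whose centre is the point
  \<open>(q - r, q + 2 * r)\<close>; its corners are listed counterclockwise. The six cells sharing an edge with
  \<open>(q, r)\<close> are obtained by adding \<open>(1, 0)\<close>, \<open>(0, 1)\<close>, \<open>(-1, 1)\<close> or their negatives.
  Hexagons of side length 1 that are glued edge to edge without overlap all lie in one such tiling.\<close>

type_synonym point = "int \<times> int"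
type_synonym cell = "int \<times> int"

definition corners :: "cell \<Rightarrow> point list" where
  "corners h = (let x = fst h - snd h; y = fst h + 2 * snd h in
     [(x + 1, y), (x, y + 1), (x - 1, y + 1), (x - 1, y), (x, y - 1), (x + 1, y - 1)])"

definition hex_verts :: "cell \<Rightarrow> point set" where
  "hex_verts h = set (corners h)"

definition hex_edges :: "cell \<Rightarrow> point set set" where
  "hex_edges h = {{corners h ! k, corners h ! (Suc k mod 6)} | k. k < 6}"

definition adjacent :: "cell \<Rightarrow> cell \<Rightarrow> bool" where
  "adjacent h h' \<longleftrightarrow> h \<noteq> h' \<and> hex_edges h \<inter> hex_edges h' \<noteq> {}"

definition adjacent_pairs :: "cell set \<Rightarrow> cell set set" where
  "adjacent_pairs H = {{h, h'} | h h'. h \<in> H \<and> h' \<in> H \<and> adjacent h h'}"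

text \<open>A benzenoid system is represented by its set of hexagons; the following is its graph.\<close>

definition bz_verts :: "cell set \<Rightarrow> point set" where
  "bz_verts H = (\<Union>h\<in>H. hex_verts h)"

definition bz_edges :: "cell set \<Rightarrow> point set set" where
  "bz_edges H = (\<Union>h\<in>H. hex_edges h)"

text \<open>Two neighbouring cells lie in the same face of this graph exactly if their common edge is not
  an edge of the graph, that is, if neither of the two belongs to \<open>H\<close>. So the last condition says
  that all cells not in \<open>H\<close> lie in the outer face, i.e. that the interior faces are the hexagons in
  \<open>H\<close>.\<close>

definition benzenoid :: "cell set \<Rightarrow> bool" where
  "benzenoid H \<longleftrightarrow> finite H \<and> graph_connected (bz_verts H) (bz_edges H) \<and>
     no_cut_vertex (bz_verts H) (bz_edges H) \<and>
     (\<forall>h h'. h \<notin> H \<longrightarrow> h' \<notin> H \<longrightarrow>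
        (h, h') \<in> {(g, g'). g \<notin> H \<and> g' \<notin> H \<and> adjacent g g'}\<^sup>*)"

definition catacondensed :: "cell set \<Rightarrow> bool" where
  "catacondensed H \<longleftrightarrow> (\<nexists>h1 h2 h3. h1 \<in> H \<and> h2 \<in> H \<and> h3 \<in> H \<and>
     h1 \<noteq> h2 \<and> h1 \<noteq> h3 \<and> h2 \<noteq> h3 \<and> hex_verts h1 \<inter> hex_verts h2 \<inter> hex_verts h3 \<noteq> {})"

definition num_spanning_trees :: "cell set \<Rightarrow> nat" where
  "num_spanning_trees H = card (spanning_trees (bz_verts H) (bz_edges H))"


section \<open>Pyrene and triphenylene chains\<close>

text \<open>The cells \<open>(q, 0)\<close> form a straight row. The cells adjacent to both \<open>(q, 0)\<close> and \<open>(q + 1, 0)\<close>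
  are \<open>(q, 1)\<close>, on one side of the row, and \<open>(q + 1, -1)\<close>, on the other.\<close>

definition pyr_u :: "nat \<Rightarrow> cell" where "pyr_u i = (2 * int i, 0)"
definition pyr_w :: "nat \<Rightarrow> cell" where "pyr_w i = (2 * int i + 1, 0)"
definition pyr_a :: "nat \<Rightarrow> cell" where "pyr_a i = (2 * int i, 1)"
definition pyr_b :: "nat \<Rightarrow> cell" where "pyr_b i = (2 * int i + 1, -1)"

definition pyrene_chain :: "nat \<Rightarrow> cell set" where
  "pyrene_chain n =
     pyr_u ` {1..n} \<union> pyr_w ` {1..n} \<union> pyr_a ` {1..n} \<union> pyr_b ` {1..n}"

text \<open>The description of the triphenylene chain does not fix the positions at which consecutive units
  are fused, so it is a property of benzenoid systems. The cardinality condition makes the \<open>4 * n\<close>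
  named hexagons distinct.\<close>

definition triphenylene_chain :: "nat \<Rightarrow> cell set \<Rightarrow> bool" where
  "triphenylene_chain n H \<longleftrightarrow> benzenoid H \<and> catacondensed H \<and> card H = 4 * n \<and>
     (\<exists>c u w b :: nat \<Rightarrow> cell.
        H = c ` {1..n} \<union> u ` {1..n} \<union> w ` {1..n} \<union> b ` {1..n} \<and>
        adjacent_pairs H =
          (\<Union>i\<in>{1..n}. {{c i, u i}, {c i, w i}, {c i, b i}}) \<union>
          (\<Union>i\<in>{1..<n}. {{w i, u (i + 1)}}))"


section \<open>Both chains exist and have the intended shape\<close>

lemma hex_verts_eq:
  "hex_verts (q, r) = {(q - r + 1, q + 2*r), (q - r, q + 2*r + 1), (q - r - 1, q + 2*r + 1),
     (q - r - 1, q + 2*r), (q - r, q + 2*r - 1), (q - r + 1, q + 2*r - 1)}"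
  by (simp add: hex_verts_def corners_def Let_def)

lemma hex_edges_eq:
  "hex_edges (q, r) =
     {{(q - r + 1, q + 2*r), (q - r, q + 2*r + 1)},
      {(q - r, q + 2*r + 1), (q - r - 1, q + 2*r + 1)},
      {(q - r - 1, q + 2*r + 1), (q - r - 1, q + 2*r)},
      {(q - r - 1, q + 2*r), (q - r, q + 2*r - 1)},
      {(q - r, q + 2*r - 1), (q - r + 1, q + 2*r - 1)},
      {(q - r + 1, q + 2*r - 1), (q - r + 1, q + 2*r)}}"
proof -
  have 6: "{k. k < 6} = {0, 1, 2, 3, 4, 5 :: nat}" by auto
  have "hex_edges (q, r) =
      (\<lambda>k. {corners (q, r) ! k, corners (q, r) ! (Suc k mod 6)}) ` {k. k < 6}"
    unfolding hex_edges_def by blast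
  then show ?thesis
    unfolding 6 image_insert image_empty corners_def Let_def by (simp add: nth_Cons')
qed

lemma hex_edges_sum:
  assumes "e \<in> hex_edges (q, r)"
  shows "(sum fst e - (2*q - 2*r) = 1 \<and> sum snd e - (2*q + 4*r) = 1) \<or>
    (sum fst e - (2*q - 2*r) = -1 \<and> sum snd e - (2*q + 4*r) = 2) \<or>
    (sum fst e - (2*q - 2*r) = -2 \<and> sum snd e - (2*q + 4*r) = 1) \<or>
    (sum fst e - (2*q - 2*r) = -1 \<and> sum snd e - (2*q + 4*r) = -1) \<or>
    (sum fst e - (2*q - 2*r) = 1 \<and> sum snd e - (2*q + 4*r) = -2) \<or>
    (sum fst e - (2*q - 2*r) = 2 \<and> sum snd e - (2*q + 4*r) = -1)"
  using assms unfolding hex_edges_eq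
  by (elim insertE emptyE) simp_all

lemma adjacent_imp_offset:
  assumes "adjacent (q, r) (q', r')"
  shows "q' = q + 1 \<and> r' = r \<or> q' = q \<and> r' = r + 1 \<or> q' = q - 1 \<and> r' = r + 1 \<or>
    q' = q - 1 \<and> r' = r \<or> q' = q \<and> r' = r - 1 \<or> q' = q + 1 \<and> r' = r - 1"
proof -
  have "(q, r) \<noteq> (q', r')" and "\<exists>e. e \<in> hex_edges (q, r) \<and> e \<in> hex_edges (q', r')"
    using assms unfolding adjacent_def by blast+
  then obtain e where ne: "q = q' \<longrightarrow> r \<noteq> r'"
    and e: "e \<in> hex_edges (q, r)" "e \<in> hex_edges (q', r')"
    by blast
  show ?thesis using hex_edges_sum[OF e(1)] hex_edges_sum[OF e(2)] ne by (smt (z3))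
qed

lemma adjacentI:
  "adjacent (q, r) (q + 1, r)" "adjacent (q, r) (q, r + 1)" "adjacent (q, r) (q - 1, r + 1)"
proof -
  have "{(q - r + 1, q + 2*r), (q - r, q + 2*r + 1)} \<in> hex_edges (q, r) \<inter> hex_edges (q + 1, r)"
    unfolding hex_edges_eq by (simp add: doubleton_eq_iff)
  then show "adjacent (q, r) (q + 1, r)" unfolding adjacent_def by auto
next
  have "{(q - r, q + 2*r + 1), (q - r - 1, q + 2*r + 1)} \<in> hex_edges (q, r) \<inter> hex_edges (q, r + 1)"
    unfolding hex_edges_eq by (simp add: doubleton_eq_iff)
  then show "adjacent (q, r) (q, r + 1)" unfolding adjacent_def by auto
next
  have "{(q - r - 1, q + 2*r + 1), (q - r - 1, q + 2*r)} \<in> hex_edges (q, r) \<inter> hex_edges (q - 1, r + 1)"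
    unfolding hex_edges_eq by (simp add: doubleton_eq_iff)
  then show "adjacent (q, r) (q - 1, r + 1)" unfolding adjacent_def by auto
qed

lemma adjacent_sym: "adjacent h h' \<longleftrightarrow> adjacent h' h"
  unfolding adjacent_def by blast

lemma adjacent_iff:
  "adjacent (q, r) (q', r') \<longleftrightarrow>
     q' = q + 1 \<and> r' = r \<or> q' = q \<and> r' = r + 1 \<or> q' = q - 1 \<and> r' = r + 1 \<or>
     q' = q - 1 \<and> r' = r \<or> q' = q \<and> r' = r - 1 \<or> q' = q + 1 \<and> r' = r - 1"
  (is "_ \<longleftrightarrow> ?offset")
proof
  show "adjacent (q, r) (q', r') \<Longrightarrow> ?offset" by (rule adjacent_imp_offset)
next
  have neg: "adjacent (q, r) (q - 1, r)" "adjacent (q, r) (q, r - 1)" "adjacent (q, r) (q + 1, r - 1)"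
    using adjacentI(1)[of "q - 1" r] adjacentI(2)[of q "r - 1"] adjacentI(3)[of "q + 1" "r - 1"]
    by (simp_all add: adjacent_sym[of "(q, r)"])
  assume ?offset
  then show "adjacent (q, r) (q', r')"
    by (elim disjE conjE) (simp_all only: adjacentI neg)
qed

lemma hex_verts_offset:
  assumes "p \<in> hex_verts (q, r)"
  shows "fst p - (q - r) = 1 \<and> snd p - (q + 2*r) = 0 \<or> fst p - (q - r) = 0 \<and> snd p - (q + 2*r) = 1 \<or>
    fst p - (q - r) = -1 \<and> snd p - (q + 2*r) = 1 \<or> fst p - (q - r) = -1 \<and> snd p - (q + 2*r) = 0 \<or>
    fst p - (q - r) = 0 \<and> snd p - (q + 2*r) = -1 \<or> fst p - (q - r) = 1 \<and> snd p - (q + 2*r) = -1"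
  using assms unfolding hex_verts_eq
  by (elim insertE emptyE) simp_all

lemma share_vertex_imp_adjacent:
  assumes "h \<noteq> h'" "p \<in> hex_verts h" "p \<in> hex_verts h'"
  shows "adjacent h h'"
proof -
  obtain q r q' r' where h: "h = (q, r)" "h' = (q', r')" by (metis surj_pair)
  have ne: "q = q' \<longrightarrow> r \<noteq> r'" using assms(1) h by blast
  show ?thesis
    unfolding h adjacent_iff
    using hex_verts_offset[OF assms(2)[unfolded h]] hex_verts_offset[OF assms(3)[unfolded h]] ne
    by (smt (z3))
qed

lemma hexagon_minus_vertex_connected:
  fixes S :: "('a \<times> 'a) set"
  assumes "distinct [A, B, C, D, E, F]" and sym: "sym S" and trans: "trans S"
    and refl: "refl S"
    and e: "A \<noteq> v \<Longrightarrow> B \<noteq> v \<Longrightarrow> (A, B) \<in> S" "B \<noteq> v \<Longrightarrow> C \<noteq> v \<Longrightarrow> (B, C) \<in> S"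
      "C \<noteq> v \<Longrightarrow> D \<noteq> v \<Longrightarrow> (C, D) \<in> S" "D \<noteq> v \<Longrightarrow> E \<noteq> v \<Longrightarrow> (D, E) \<in> S"
      "E \<noteq> v \<Longrightarrow> F \<noteq> v \<Longrightarrow> (E, F) \<in> S" "F \<noteq> v \<Longrightarrow> A \<noteq> v \<Longrightarrow> (F, A) \<in> S"
    and xy: "x \<in> {A, B, C, D, E, F}" "y \<in> {A, B, C, D, E, F}" "x \<noteq> v" "y \<noteq> v"
  shows "(x, y) \<in> S"
proof -
  note s = symD[OF sym] and t = transD[OF trans] and r = refl_onD[OF refl UNIV_I]
  have "\<exists>z. \<forall>x \<in> {A, B, C, D, E, F} - {v}. (z, x) \<in> S"
  proof -
    consider "v = A" | "v = B" | "v = C" | "v = D" | "v = E" | "v = F" | "v \<notin> {A, B, C, D, E, F}"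
      by auto
    then show ?thesis
    proof cases
      case 1
      have n: "(B, C) \<in> S" "(C, D) \<in> S" "(D, E) \<in> S" "(E, F) \<in> S" using e assms(1) 1 by auto
      have m: "(B, D) \<in> S" "(B, E) \<in> S" "(B, F) \<in> S" using t n by metis+
      show ?thesis using n m r[of B] 1 by (intro exI[of _ B]) auto
    next
      case 2
      have n: "(C, D) \<in> S" "(D, E) \<in> S" "(E, F) \<in> S" "(F, A) \<in> S" using e assms(1) 2 by auto
      have m: "(C, E) \<in> S" "(C, F) \<in> S" "(C, A) \<in> S" using t n by metis+
      show ?thesis using n m r[of C] 2 by (intro exI[of _ C]) auto
    next
      case 3
      have n: "(D, E) \<in> S" "(E, F) \<in> S" "(F, A) \<in> S" "(A, B) \<in> S" using e assms(1) 3 by auto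
      have m: "(D, F) \<in> S" "(D, A) \<in> S" "(D, B) \<in> S" using t n by metis+
      show ?thesis using n m r[of D] 3 by (intro exI[of _ D]) auto
    next
      case 4
      have n: "(E, F) \<in> S" "(F, A) \<in> S" "(A, B) \<in> S" "(B, C) \<in> S" using e assms(1) 4 by auto
      have m: "(E, A) \<in> S" "(E, B) \<in> S" "(E, C) \<in> S" using t n by metis+
      show ?thesis using n m r[of E] 4 by (intro exI[of _ E]) auto
    next
      case 5
      have n: "(F, A) \<in> S" "(A, B) \<in> S" "(B, C) \<in> S" "(C, D) \<in> S" using e assms(1) 5 by auto
      have m: "(F, B) \<in> S" "(F, C) \<in> S" "(F, D) \<in> S" using t n by metis+
      show ?thesis using n m r[of F] 5 by (intro exI[of _ F]) auto
    next
      case 6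
      have n: "(A, B) \<in> S" "(B, C) \<in> S" "(C, D) \<in> S" "(D, E) \<in> S" using e assms(1) 6 by auto
      have m: "(A, C) \<in> S" "(A, D) \<in> S" "(A, E) \<in> S" using t n by metis+
      show ?thesis using n m r[of A] 6 by (intro exI[of _ A]) auto
    next
      case 7
      have n: "(A, B) \<in> S" "(B, C) \<in> S" "(C, D) \<in> S" "(D, E) \<in> S" "(E, F) \<in> S" using e 7 by auto
      have m: "(A, C) \<in> S" "(A, D) \<in> S" "(A, E) \<in> S" "(A, F) \<in> S" using t n by metis+
      show ?thesis using n m r[of A] 7 by (intro exI[of _ A]) auto
    qed
  qed
  then show ?thesis using s t xy by (metis DiffI singletonD)
qed

lemma adjacent_share_two_vertices:
  assumes "adjacent h h'"
  shows "\<exists>a b. a \<noteq> b \<and> {a, b} \<subseteq> hex_verts h \<inter> hex_verts h'"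
proof -
  obtain q r q' r' where h: "h = (q, r)" "h' = (q', r')" by fastforce
  obtain e where e: "e \<in> hex_edges h" "e \<in> hex_edges h'" using assms by (auto simp: adjacent_def)
  have "\<exists>a b. e = {a, b} \<and> a \<noteq> b"
  proof -
    show ?thesis
      using e(1) unfolding h hex_edges_eq
      by (elim insertE emptyE) (rule exI, rule exI, rule conjI, assumption, simp)+
  qed
  moreover have "e \<subseteq> hex_verts h"
    using e(1) unfolding h hex_edges_eq hex_verts_eq by (elim insertE emptyE) auto
  moreover have "e \<subseteq> hex_verts h'"
    using e(2) unfolding h hex_edges_eq hex_verts_eq by (elim insertE emptyE) auto
  ultimately show ?thesis by blast
qed

lemma bz_minus_vertex_connected:
  assumes con: "\<And>h h'. h \<in> H \<Longrightarrow> h' \<in> H \<Longrightarrow>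
      (h, h') \<in> {(g, g'). g \<in> H \<and> g' \<in> H \<and> adjacent g g'}\<^sup>*"
    and ne: "H \<noteq> {}"
  shows "graph_connected (bz_verts H - {v}) {e \<in> bz_edges H. v \<notin> e}"
proof -
  define S where "S = {(a, b). a \<noteq> b \<and> {a, b} \<in> {e \<in> bz_edges H. v \<notin> e}}\<^sup>*"
  have S: "sym S" "trans S" "refl S"
    unfolding S_def
    by (rule sym_rtrancl trans_rtrancl refl_rtrancl; auto simp: sym_def insert_commute)+
  have hex: "(p, p') \<in> S" if "h \<in> H" "p \<in> hex_verts h" "p' \<in> hex_verts h" "p \<noteq> v" "p' \<noteq> v" for h p p'
  proof -
    obtain q r where h: "h = (q, r)" by fastforce
    have e: "(a, b) \<in> S" if "{a, b} \<in> hex_edges h" "a \<noteq> b" "a \<noteq> v" "b \<noteq> v" for a b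
      unfolding S_def using that \<open>h \<in> H\<close> by (intro r_into_rtrancl) (auto simp: bz_edges_def)
    show ?thesis
      by (rule hexagon_minus_vertex_connected[where v = v, OF _ S e e e e e e
            that(2,3)[unfolded h hex_verts_eq] that(4,5)])
         (simp_all add: h hex_edges_eq)
  qed
  have "(p, p') \<in> S"
    if "(h, h') \<in> {(g, g'). g \<in> H \<and> g' \<in> H \<and> adjacent g g'}\<^sup>*" "h \<in> H"
      "p \<in> hex_verts h" "p' \<in> hex_verts h'" "p \<noteq> v" "p' \<noteq> v" for h h' p p'
    using that(1,4,6)
  proof (induction arbitrary: p' rule: rtrancl_induct)
    case base
    then show ?case using hex that by blast
  next
    case (step g g')
    then have g: "g' \<in> H" "adjacent g g'" by auto
    obtain a where a: "a \<in> hex_verts g" "a \<in> hex_verts g'" "a \<noteq> v"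
      using adjacent_share_two_vertices[OF g(2)] by blast
    have "(p, a) \<in> S" using step.IH a by blast
    moreover have "(a, p') \<in> S" using hex[OF g(1) a(2)] step.prems a by blast
    ultimately show ?case using S(2) by (blast dest: transD)
  qed
  then have "\<forall>x\<in>bz_verts H - {v}. \<forall>y\<in>bz_verts H - {v}. (x, y) \<in> S"
    using con unfolding bz_verts_def by blast
  moreover have "bz_verts H - {v} \<noteq> {}"
  proof -
    obtain q r where "(q, r) \<in> H" using ne by fastforce
    then have "(q - r + 1, q + 2*r) \<in> bz_verts H" "(q - r - 1, q + 2*r) \<in> bz_verts H"
      by (auto simp: bz_verts_def hex_verts_eq intro!: bexI[of _ "(q, r)"])
    then show ?thesis by (cases "v = (q - r + 1, q + 2*r)") auto
  qed
  ultimately show ?thesis by (auto simp: graph_connected_def S_def)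
qed

lemma bz_connected:
  assumes con: "\<And>h h'. h \<in> H \<Longrightarrow> h' \<in> H \<Longrightarrow>
      (h, h') \<in> {(g, g'). g \<in> H \<and> g' \<in> H \<and> adjacent g g'}\<^sup>*"
    and ne: "H \<noteq> {}" and fin: "finite H"
  shows "graph_connected (bz_verts H) (bz_edges H)"
proof -
  have "finite (bz_verts H)" using fin by (auto simp: bz_verts_def hex_verts_def)
  then obtain v :: point where v: "v \<notin> bz_verts H"
    by (metis ex_new_if_finite infinite_UNIV_char_0 finite_Prod_UNIV finite_prod)
  have "e \<subseteq> hex_verts h" if "e \<in> hex_edges h" for e h
    using that by (cases h) (auto simp: hex_edges_eq hex_verts_eq)
  then have "{e \<in> bz_edges H. v \<notin> e} = bz_edges H"
    using v by (fastforce simp: bz_edges_def bz_verts_def)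
  with v bz_minus_vertex_connected[OF con ne, of v] show ?thesis by simp
qed

lemma complement_connected:
  fixes K :: int
  assumes box: "\<And>q r. (q, r) \<in> H \<Longrightarrow> \<bar>q\<bar> < K \<and> \<bar>r\<bar> < K"
    and col: "\<And>q r. (q, r) \<notin> H \<Longrightarrow>
      (\<forall>r'\<ge>r. (q, r') \<notin> H) \<or> (\<forall>r'\<le>r. (q, r') \<notin> H)"
    and "h \<notin> H" "h' \<notin> H"
  shows "(h, h') \<in> {(g, g'). g \<notin> H \<and> g' \<notin> H \<and> adjacent g g'}\<^sup>*"
proof -
  define S where "S = {(g, g'). g \<notin> H \<and> g' \<notin> H \<and> adjacent g g'}\<^sup>*"
  have sym: "sym S" and trans: "trans S" unfolding S_def
    by (rule sym_rtrancl trans_rtrancl; auto simp: sym_def adjacent_sym)+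
  have vert: "((q, r), (q, s)) \<in> S" if "r \<le> s" "\<forall>t. r \<le> t \<and> t \<le> s \<longrightarrow> (q, t) \<notin> H" for q r s
    using that
  proof (induction s rule: int_ge_induct)
    case base
    show ?case by (simp add: S_def)
  next
    case (step s)
    have "((q, s), (q, s + 1)) \<in> S"
      using step unfolding S_def by (intro r_into_rtrancl) (auto simp: adjacent_iff)
    with step trans show ?case by (auto dest: transD)
  qed
  have hor: "((q, r), (q', r)) \<in> S" if "q \<le> q'" "\<forall>t. q \<le> t \<and> t \<le> q' \<longrightarrow> (t, r) \<notin> H" for q r q'
    using that
  proof (induction q' rule: int_ge_induct)
    case base
    show ?case by (simp add: S_def)
  next
    case (step s)
    have "((s, r), (s + 1, r)) \<in> S"
      using step unfolding S_def by (intro r_into_rtrancl) (auto simp: adjacent_iff)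
    with step trans show ?case by (auto dest: transD)
  qed
  have out: "(q, r) \<notin> H" if "K \<le> \<bar>q\<bar> \<or> K \<le> \<bar>r\<bar>" for q r
    using box[of q r] that by fastforce
  have reach: "((q, r), (K, 0)) \<in> S" if "(q, r) \<notin> H" for q r
  proof -
    obtain s where s: "((q, r), (q, s)) \<in> S" "K \<le> \<bar>s\<bar>"
    proof (cases "\<forall>r'\<ge>r. (q, r') \<notin> H")
      case True
      then have "((q, r), (q, max r K)) \<in> S" by (intro vert) auto
      then show ?thesis by (rule that) auto
    next
      case False
      then have "\<forall>r'\<le>r. (q, r') \<notin> H" using col[OF \<open>(q, r) \<notin> H\<close>] by blast
      then have "((q, min r (- K)), (q, r)) \<in> S" by (intro vert) auto
      then have "((q, r), (q, min r (- K))) \<in> S" by (rule symD[OF sym])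
      then show ?thesis by (rule that) auto
    qed
    define t where "t = max q K"
    have "((q, s), (t, s)) \<in> S" using s(2) by (intro hor) (auto simp: t_def intro!: out)
    moreover have "((t, s), (t, 0)) \<in> S"
    proof (cases "s \<le> 0")
      case True
      then show ?thesis by (intro vert) (auto simp: t_def intro!: out)
    next
      case False
      then have "((t, 0), (t, s)) \<in> S" by (intro vert) (auto simp: t_def intro!: out)
      then show ?thesis by (rule symD[OF sym])
    qed
    moreover have "((K, 0), (t, 0)) \<in> S" by (intro hor) (auto simp: t_def intro!: out)
    ultimately show ?thesis using s(1) symD[OF sym] transD[OF trans] by metis
  qed
  have "(h, (K, 0)) \<in> S" "(h', (K, 0)) \<in> S" using reach assms(3,4) by (metis surj_pair)+
  then show ?thesis unfolding S_def[symmetric] using symD[OF sym] transD[OF trans] by metis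
qed

lemma benzenoidI:
  assumes "finite H" "H \<noteq> {}"
    and con: "\<And>h h'. h \<in> H \<Longrightarrow> h' \<in> H \<Longrightarrow>
      (h, h') \<in> {(g, g'). g \<in> H \<and> g' \<in> H \<and> adjacent g g'}\<^sup>*"
    and col: "\<And>q r. (q, r) \<notin> H \<Longrightarrow>
      (\<forall>r'\<ge>r. (q, r') \<notin> H) \<or> (\<forall>r'\<le>r. (q, r') \<notin> H)"
  shows "benzenoid H"
proof -
  define K :: int where "K = 1 + (\<Sum>h\<in>H. \<bar>fst h\<bar> + \<bar>snd h\<bar>)"
  have "\<bar>q\<bar> < K \<and> \<bar>r\<bar> < K" if "(q, r) \<in> H" for q r
    using member_le_sum[OF that, of "\<lambda>h. \<bar>fst h\<bar> + \<bar>snd h\<bar>"] assms(1) by (auto simp: K_def)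
  then show ?thesis
    unfolding benzenoid_def no_cut_vertex_def
    using assms(1,2) bz_connected[OF con] bz_minus_vertex_connected[OF con]
      complement_connected[OF _ col] by blast
qed

text \<open>A set consisting of \<open>n\<close> connected units, consecutive ones of which are adjacent.\<close>

lemma chain_adjacency_connected:
  fixes c :: "nat \<Rightarrow> cell" and f :: "nat \<Rightarrow> cell set"
  assumes H: "H = (\<Union>i\<in>{1..n}. f i)"
    and f: "\<And>i. i \<in> {1..n} \<Longrightarrow> c i \<in> f i"
    and unit: "\<And>i h. i \<in> {1..n} \<Longrightarrow> h \<in> f i \<Longrightarrow>
        (c i, h) \<in> {(g, g'). g \<in> H \<and> g' \<in> H \<and> adjacent g g'}\<^sup>*"
    and nxt: "\<And>i. i \<in> {1..<n} \<Longrightarrow>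
        (c i, c (Suc i)) \<in> {(g, g'). g \<in> H \<and> g' \<in> H \<and> adjacent g g'}\<^sup>*"
    and hh: "h \<in> H" "h' \<in> H"
  shows "(h, h') \<in> {(g, g'). g \<in> H \<and> g' \<in> H \<and> adjacent g g'}\<^sup>*"
proof -
  define S where "S = {(g, g'). g \<in> H \<and> g' \<in> H \<and> adjacent g g'}\<^sup>*"
  have sym: "sym S" and trans: "trans S" unfolding S_def
    by (rule sym_rtrancl trans_rtrancl; auto simp: sym_def adjacent_sym)+
  have first: "i \<in> {1..n} \<longrightarrow> (c 1, c i) \<in> S" for i
  proof (induction i)
    case (Suc i)
    show ?case
    proof (cases "i = 0")
      case False
      show ?thesis
      proof
        assume "Suc i \<in> {1..n}"
        then have "(c 1, c i) \<in> S" "(c i, c (Suc i)) \<in> S"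
          using False Suc nxt[of i] by (auto simp: S_def)
        then show "(c 1, c (Suc i)) \<in> S" by (rule transD[OF trans])
      qed
    qed (simp add: S_def)
  qed simp
  have reach: "(c 1, g) \<in> S" if g: "g \<in> H" for g
  proof -
    obtain i where i: "i \<in> {1..n}" "g \<in> f i" using g H by blast
    then have "(c 1, c i) \<in> S" "(c i, g) \<in> S" using first unit by (auto simp: S_def)
    then show ?thesis by (rule transD[OF trans])
  qed
  have "(h, c 1) \<in> S" using reach[OF hh(1)] by (rule symD[OF sym])
  from transD[OF trans this reach[OF hh(2)]] show ?thesis by (simp only: S_def)
qed

lemma pyr_adjacent:
  "adjacent (pyr_u i) (pyr_u j) \<longleftrightarrow> False"
  "adjacent (pyr_w i) (pyr_w j) \<longleftrightarrow> False"
  "adjacent (pyr_a i) (pyr_a j) \<longleftrightarrow> False"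
  "adjacent (pyr_b i) (pyr_b j) \<longleftrightarrow> False"
  "adjacent (pyr_u i) (pyr_w j) \<longleftrightarrow> j = i \<or> i = Suc j"
  "adjacent (pyr_w j) (pyr_u i) \<longleftrightarrow> j = i \<or> i = Suc j"
  "adjacent (pyr_u i) (pyr_a j) \<longleftrightarrow> j = i"
  "adjacent (pyr_a j) (pyr_u i) \<longleftrightarrow> j = i"
  "adjacent (pyr_u i) (pyr_b j) \<longleftrightarrow> j = i"
  "adjacent (pyr_b j) (pyr_u i) \<longleftrightarrow> j = i"
  "adjacent (pyr_w i) (pyr_a j) \<longleftrightarrow> j = i"
  "adjacent (pyr_a j) (pyr_w i) \<longleftrightarrow> j = i"
  "adjacent (pyr_w i) (pyr_b j) \<longleftrightarrow> j = i"
  "adjacent (pyr_b j) (pyr_w i) \<longleftrightarrow> j = i"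
  "adjacent (pyr_a i) (pyr_b j) \<longleftrightarrow> False"
  "adjacent (pyr_b j) (pyr_a i) \<longleftrightarrow> False"
  unfolding pyr_u_def pyr_w_def pyr_a_def pyr_b_def adjacent_iff by presburger+

lemma finite_pyrene_chain: "finite (pyrene_chain n)"
  by (simp add: pyrene_chain_def)

lemma card_pyrene_chain: "card (pyrene_chain n) = 4 * n"
proof -
  note defs = pyr_u_def pyr_w_def pyr_a_def pyr_b_def
  have "inj_on pyr_u {1..n}" "inj_on pyr_w {1..n}" "inj_on pyr_a {1..n}" "inj_on pyr_b {1..n}"
    by (auto simp: inj_on_def defs)
  then have "card (pyr_u ` {1..n}) = n" "card (pyr_w ` {1..n}) = n"
      "card (pyr_a ` {1..n}) = n" "card (pyr_b ` {1..n}) = n"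
    by (simp_all add: card_image)
  moreover have "pyr_u ` {1..n} \<inter> pyr_w ` {1..n} = {}"
    unfolding defs by (auto; presburger)
  moreover have "(pyr_u ` {1..n} \<union> pyr_w ` {1..n}) \<inter> pyr_a ` {1..n} = {}"
    unfolding defs by auto
  moreover have "(pyr_u ` {1..n} \<union> pyr_w ` {1..n} \<union> pyr_a ` {1..n}) \<inter> pyr_b ` {1..n} = {}"
    unfolding defs by auto
  ultimately show ?thesis unfolding pyrene_chain_def by (simp add: card_Un_disjoint)
qed

lemma adjacent_pairs_pyrene_chain:
  "adjacent_pairs (pyrene_chain n) =
     (\<Union>i\<in>{1..n}. {{pyr_u i, pyr_w i}, {pyr_u i, pyr_a i}, {pyr_u i, pyr_b i},
        {pyr_w i, pyr_a i}, {pyr_w i, pyr_b i}}) \<union>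
     (\<Union>i\<in>{1..<n}. {{pyr_w i, pyr_u (i + 1)}})" (is "?L = ?R")
proof
  show "?L \<subseteq> ?R"
  proof
    fix e assume "e \<in> ?L"
    then obtain h h' where e: "e = {h, h'}" and h: "h \<in> pyrene_chain n" "h' \<in> pyrene_chain n"
      and adj: "adjacent h h'" unfolding adjacent_pairs_def by blast
    show "e \<in> ?R"
      using h adj unfolding e pyrene_chain_def
      by (elim UnE imageE) (simp_all add: pyr_adjacent, auto simp: insert_commute)
  qed
next
  have "{h, h'} \<in> ?L" if "h \<in> pyrene_chain n" "h' \<in> pyrene_chain n" "adjacent h h'" for h h'
    using that unfolding adjacent_pairs_def by blast
  note I = this
  have mem: "pyr_u i \<in> pyrene_chain n" "pyr_w i \<in> pyrene_chain n" "pyr_a i \<in> pyrene_chain n"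
    "pyr_b i \<in> pyrene_chain n" if "i \<in> {1..n}" for i
    using that by (auto simp: pyrene_chain_def)
  have "{{pyr_u i, pyr_w i}, {pyr_u i, pyr_a i}, {pyr_u i, pyr_b i},
        {pyr_w i, pyr_a i}, {pyr_w i, pyr_b i}} \<subseteq> ?L" if "i \<in> {1..n}" for i
    using I mem[OF that] by (simp add: pyr_adjacent)
  moreover have "{pyr_w i, pyr_u (i + 1)} \<in> ?L" if "i \<in> {1..<n}" for i
    using that by (intro I mem) (auto simp: pyr_adjacent)
  ultimately show "?R \<subseteq> ?L" by blast
qed

lemma benzenoid_pyrene_chain:
  assumes "n \<ge> 1"
  shows "benzenoid (pyrene_chain n)"
proof (rule benzenoidI)
  define f where "f i = {pyr_u i, pyr_w i, pyr_a i, pyr_b i}" for i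
  have H: "pyrene_chain n = (\<Union>i\<in>{1..n}. f i)" by (auto simp: pyrene_chain_def f_def)
  fix h h' assume "h \<in> pyrene_chain n" "h' \<in> pyrene_chain n"
  show "(h, h') \<in> {(g, g'). g \<in> pyrene_chain n \<and> g' \<in> pyrene_chain n \<and> adjacent g g'}\<^sup>*"
  proof (rule chain_adjacency_connected[where f = f and c = pyr_u, OF H])
    have mem: "pyr_u i \<in> pyrene_chain n" "pyr_w i \<in> pyrene_chain n" "pyr_a i \<in> pyrene_chain n"
      "pyr_b i \<in> pyrene_chain n" if "i \<in> {1..n}" for i
      using that by (auto simp: pyrene_chain_def)
    fix i assume i: "i \<in> {1..<n}"
    then have "i \<in> {1..n}" "Suc i \<in> {1..n}" by auto
    note m = mem[OF this(1)] mem[OF this(2)]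
    have 1: "(pyr_u i, pyr_w i) \<in> {(g, g'). g \<in> pyrene_chain n \<and> g' \<in> pyrene_chain n \<and> adjacent g g'}\<^sup>*"
      by (rule r_into_rtrancl) (simp add: m pyr_adjacent)
    have 2: "(pyr_w i, pyr_u (Suc i)) \<in> {(g, g'). g \<in> pyrene_chain n \<and> g' \<in> pyrene_chain n \<and> adjacent g g'}\<^sup>*"
      by (rule r_into_rtrancl) (simp add: m pyr_adjacent)
    show "(pyr_u i, pyr_u (Suc i)) \<in>
        {(g, g'). g \<in> pyrene_chain n \<and> g' \<in> pyrene_chain n \<and> adjacent g g'}\<^sup>*"
      by (rule rtrancl_trans[OF 1 2])
  next
    fix i g assume i: "i \<in> {1..n}" and g: "g \<in> f i"
    then have "g \<in> pyrene_chain n" "pyr_u i \<in> pyrene_chain n" unfolding H f_def by auto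
    moreover have "g = pyr_u i \<or> adjacent (pyr_u i) g"
      using g by (auto simp: f_def pyr_adjacent)
    ultimately show "(pyr_u i, g) \<in>
        {(g, g'). g \<in> pyrene_chain n \<and> g' \<in> pyrene_chain n \<and> adjacent g g'}\<^sup>*"
      by (auto intro: r_into_rtrancl)
  qed (use \<open>h \<in> _\<close> \<open>h' \<in> _\<close> in \<open>auto simp: f_def\<close>)
next
  fix q r assume "(q, r) \<notin> pyrene_chain n"
  then have nu: "\<And>i. i \<in> {1..n} \<Longrightarrow> (q, r) \<noteq> pyr_u i" and nw: "\<And>i. i \<in> {1..n} \<Longrightarrow> (q, r) \<noteq> pyr_w i"
    and na: "\<And>i. i \<in> {1..n} \<Longrightarrow> (q, r) \<noteq> pyr_a i" and nb: "\<And>i. i \<in> {1..n} \<Longrightarrow> (q, r) \<noteq> pyr_b i"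
    unfolding pyrene_chain_def by blast+
  show "(\<forall>r'\<ge>r. (q, r') \<notin> pyrene_chain n) \<or> (\<forall>r'\<le>r. (q, r') \<notin> pyrene_chain n)"
  proof (rule ccontr)
    assume "\<not> ?thesis"
    then obtain s t where st: "s \<ge> r" "t \<le> r" "(q, s) \<in> pyrene_chain n" "(q, t) \<in> pyrene_chain n"
      by blast
    have *: "(\<exists>i\<in>{1..n}. q = 2 * int i \<and> (x = 0 \<or> x = 1)) \<or>
        (\<exists>i\<in>{1..n}. q = 2 * int i + 1 \<and> (x = 0 \<or> x = -1))" if "(q, x) \<in> pyrene_chain n" for x
      using that unfolding pyrene_chain_def pyr_u_def pyr_w_def pyr_a_def pyr_b_def by auto
    consider i where "i \<in> {1..n}" "q = 2 * int i" | i where "i \<in> {1..n}" "q = 2 * int i + 1"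
      using *[OF st(3)] by blast
    then show False
    proof cases
      case i: (1 i)
      have "t = 0 \<or> t = 1" using *[OF st(4)] i(2) by (elim disjE bexE conjE; presburger)
      moreover have "s = 0 \<or> s = 1" using *[OF st(3)] i(2) by (elim disjE bexE conjE; presburger)
      ultimately have "r = 0 \<or> r = 1" using st(1,2) by linarith
      then show False using nu[OF i(1)] na[OF i(1)] i(2) by (auto simp: pyr_u_def pyr_a_def)
    next
      case i: (2 i)
      have "t = 0 \<or> t = -1" using *[OF st(4)] i(2) by (elim disjE bexE conjE; presburger)
      moreover have "s = 0 \<or> s = -1" using *[OF st(3)] i(2) by (elim disjE bexE conjE; presburger)
      ultimately have "r = 0 \<or> r = -1" using st(1,2) by linarith
      then show False using nw[OF i(1)] nb[OF i(1)] i(2) by (auto simp: pyr_w_def pyr_b_def)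
    qed
  qed
qed (use assms in \<open>auto simp: pyrene_chain_def\<close>)

definition tri_c :: "nat \<Rightarrow> cell" where "tri_c i = (3 * int i, - int i)"
definition tri_u :: "nat \<Rightarrow> cell" where "tri_u i = (3 * int i - 1, - int i)"
definition tri_w :: "nat \<Rightarrow> cell" where "tri_w i = (3 * int i + 1, - int i - 1)"
definition tri_b :: "nat \<Rightarrow> cell" where "tri_b i = (3 * int i, 1 - int i)"

lemma tri_adjacent:
  "adjacent (tri_c i) (tri_c j) \<longleftrightarrow> False"
  "adjacent (tri_u i) (tri_u j) \<longleftrightarrow> False"
  "adjacent (tri_w i) (tri_w j) \<longleftrightarrow> False"
  "adjacent (tri_b i) (tri_b j) \<longleftrightarrow> False"
  "adjacent (tri_c i) (tri_u j) \<longleftrightarrow> j = i"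
  "adjacent (tri_u j) (tri_c i) \<longleftrightarrow> j = i"
  "adjacent (tri_c i) (tri_w j) \<longleftrightarrow> j = i"
  "adjacent (tri_w j) (tri_c i) \<longleftrightarrow> j = i"
  "adjacent (tri_c i) (tri_b j) \<longleftrightarrow> j = i"
  "adjacent (tri_b j) (tri_c i) \<longleftrightarrow> j = i"
  "adjacent (tri_u i) (tri_w j) \<longleftrightarrow> i = Suc j"
  "adjacent (tri_w j) (tri_u i) \<longleftrightarrow> i = Suc j"
  "adjacent (tri_u i) (tri_b j) \<longleftrightarrow> False"
  "adjacent (tri_b j) (tri_u i) \<longleftrightarrow> False"
  "adjacent (tri_w i) (tri_b j) \<longleftrightarrow> False"
  "adjacent (tri_b j) (tri_w i) \<longleftrightarrow> False"
  unfolding tri_c_def tri_u_def tri_w_def tri_b_def adjacent_iff by presburger+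

text \<open>The hypothesis on the triphenylene chain can be met for every \<open>n\<close>.\<close>

lemma ex_triphenylene_chain:
  assumes "n \<ge> 1"
  shows "\<exists>H. triphenylene_chain n H"
proof -
  note defs = tri_c_def tri_u_def tri_w_def tri_b_def
  define H where "H = tri_c ` {1..n} \<union> tri_u ` {1..n} \<union> tri_w ` {1..n} \<union> tri_b ` {1..n}"
  have "benzenoid H"
  proof (rule benzenoidI)
    define f where "f i = {tri_c i, tri_u i, tri_w i, tri_b i}" for i
    have Hf: "H = (\<Union>i\<in>{1..n}. f i)" by (auto simp: H_def f_def)
    fix h h' assume "h \<in> H" "h' \<in> H"
    show "(h, h') \<in> {(g, g'). g \<in> H \<and> g' \<in> H \<and> adjacent g g'}\<^sup>*"
    proof (rule chain_adjacency_connected[where f = f and c = tri_c, OF Hf])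
      have mem: "tri_c i \<in> H" "tri_u i \<in> H" "tri_w i \<in> H" "tri_b i \<in> H" if "i \<in> {1..n}" for i
        using that by (auto simp: H_def)
      fix i assume i: "i \<in> {1..<n}"
      then have "i \<in> {1..n}" "Suc i \<in> {1..n}" by auto
      note m = mem[OF this(1)] mem[OF this(2)]
      have 1: "(tri_c i, tri_w i) \<in> {(g, g'). g \<in> H \<and> g' \<in> H \<and> adjacent g g'}\<^sup>*"
        by (rule r_into_rtrancl) (simp add: m tri_adjacent)
      have 2: "(tri_w i, tri_u (Suc i)) \<in> {(g, g'). g \<in> H \<and> g' \<in> H \<and> adjacent g g'}\<^sup>*"
        by (rule r_into_rtrancl) (simp add: m tri_adjacent)
      have 3: "(tri_u (Suc i), tri_c (Suc i)) \<in> {(g, g'). g \<in> H \<and> g' \<in> H \<and> adjacent g g'}\<^sup>*"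
        by (rule r_into_rtrancl) (simp add: m tri_adjacent)
      show "(tri_c i, tri_c (Suc i)) \<in> {(g, g'). g \<in> H \<and> g' \<in> H \<and> adjacent g g'}\<^sup>*"
        by (rule rtrancl_trans[OF 1 rtrancl_trans[OF 2 3]])
    next
      fix i g assume i: "i \<in> {1..n}" and g: "g \<in> f i"
      then have "g \<in> H" "tri_c i \<in> H" unfolding Hf f_def by auto
      moreover have "g = tri_c i \<or> adjacent (tri_c i) g"
        using g by (auto simp: f_def tri_adjacent)
      ultimately show "(tri_c i, g) \<in> {(g, g'). g \<in> H \<and> g' \<in> H \<and> adjacent g g'}\<^sup>*"
        by (auto intro: r_into_rtrancl)
    qed (use \<open>h \<in> H\<close> \<open>h' \<in> H\<close> in \<open>auto simp: f_def\<close>)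
  next
    fix q r assume "(q, r) \<notin> H"
    then have nc: "\<And>i. i \<in> {1..n} \<Longrightarrow> (q, r) \<noteq> tri_c i" and nu: "\<And>i. i \<in> {1..n} \<Longrightarrow> (q, r) \<noteq> tri_u i"
      and nw: "\<And>i. i \<in> {1..n} \<Longrightarrow> (q, r) \<noteq> tri_w i" and nb: "\<And>i. i \<in> {1..n} \<Longrightarrow> (q, r) \<noteq> tri_b i"
      unfolding H_def by blast+
    show "(\<forall>r'\<ge>r. (q, r') \<notin> H) \<or> (\<forall>r'\<le>r. (q, r') \<notin> H)"
    proof (rule ccontr)
      assume "\<not> ?thesis"
      then obtain s t where st: "s \<ge> r" "t \<le> r" "(q, s) \<in> H" "(q, t) \<in> H"
        by blast
      have *: "(\<exists>i\<in>{1..n}. q = 3 * int i \<and> (x = - int i \<or> x = 1 - int i)) \<or>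
          (\<exists>i\<in>{1..n}. q = 3 * int i - 1 \<and> x = - int i) \<or>
          (\<exists>i\<in>{1..n}. q = 3 * int i + 1 \<and> x = - int i - 1)" if "(q, x) \<in> H" for x
        using that unfolding H_def defs by auto
      have **: "(\<exists>j. q = 3 * j \<and> (x = - j \<or> x = 1 - j)) \<or>
          (\<exists>j. q = 3 * j - 1 \<and> x = - j) \<or> (\<exists>j. q = 3 * j + 1 \<and> x = - j - 1)"
        if "(q, x) \<in> H" for x
        using *[OF that] by blast
      from *[OF st(3)] show False
      proof (elim disjE bexE conjE)
        fix i assume i: "i \<in> {1..n}" "q = 3 * int i - 1" and s: "s = - int i"
        have "t = - int i" using **[OF st(4)] i(2) by presburger
        then have "r = - int i" using st s by simp
        then show False using nu[OF i(1)] i(2) by (auto simp: defs)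
      next
        fix i assume i: "i \<in> {1..n}" "q = 3 * int i + 1" and s: "s = - int i - 1"
        have "t = - int i - 1" using **[OF st(4)] i(2) by presburger
        then have "r = - int i - 1" using st s by simp
        then show False using nw[OF i(1)] i(2) by (auto simp: defs)
      next
        fix i assume i: "i \<in> {1..n}" "q = 3 * int i" and s: "s = - int i"
        have "t = - int i \<or> t = 1 - int i" using **[OF st(4)] i(2) by presburger
        then have "r = - int i \<or> r = 1 - int i" using st s by linarith
        then show False using nc[OF i(1)] nb[OF i(1)] i(2) by (auto simp: defs)
      next
        fix i assume i: "i \<in> {1..n}" "q = 3 * int i" and s: "s = 1 - int i"
        have "t = - int i \<or> t = 1 - int i" using **[OF st(4)] i(2) by presburger
        then have "r = - int i \<or> r = 1 - int i" using st s by linarith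
        then show False using nc[OF i(1)] nb[OF i(1)] i(2) by (auto simp: defs)
      qed
    qed
  qed (use assms in \<open>auto simp: H_def\<close>)
  moreover have "catacondensed H"
  proof -
    have False if "h1 \<in> H" "h2 \<in> H" "h3 \<in> H" "adjacent h1 h2" "adjacent h1 h3" "adjacent h2 h3"
      for h1 h2 h3
      using that unfolding H_def by (elim UnE imageE) (simp_all add: tri_adjacent)
    then show ?thesis unfolding catacondensed_def using share_vertex_imp_adjacent by blast
  qed
  moreover have "card H = 4 * n"
  proof -
    have "inj_on tri_c {1..n}" "inj_on tri_u {1..n}" "inj_on tri_w {1..n}" "inj_on tri_b {1..n}"
      by (auto simp: inj_on_def defs)
    then have "card (tri_c ` {1..n}) = n" "card (tri_u ` {1..n}) = n"
        "card (tri_w ` {1..n}) = n" "card (tri_b ` {1..n}) = n"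
      by (simp_all add: card_image)
    moreover have ne: "tri_c i \<noteq> tri_u j" "tri_c i \<noteq> tri_w j" "tri_u i \<noteq> tri_w j"
      "tri_c i \<noteq> tri_b j" "tri_u i \<noteq> tri_b j" "tri_w i \<noteq> tri_b j" for i j
      unfolding defs prod.inject by presburger+
    moreover have "tri_c ` {1..n} \<inter> tri_u ` {1..n} = {}"
      using ne by blast
    moreover have "(tri_c ` {1..n} \<union> tri_u ` {1..n}) \<inter> tri_w ` {1..n} = {}"
      using ne by blast
    moreover have "(tri_c ` {1..n} \<union> tri_u ` {1..n} \<union> tri_w ` {1..n}) \<inter> tri_b ` {1..n} = {}"
      using ne by blast
    ultimately show ?thesis unfolding H_def by (simp add: card_Un_disjoint)
  qed
  moreover have "adjacent_pairs H =
      (\<Union>i\<in>{1..n}. {{tri_c i, tri_u i}, {tri_c i, tri_w i}, {tri_c i, tri_b i}}) \<union>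
      (\<Union>i\<in>{1..<n}. {{tri_w i, tri_u (i + 1)}})" (is "?L = ?R")
  proof
    show "?L \<subseteq> ?R"
    proof
      fix e assume "e \<in> ?L"
      then obtain h h' where e: "e = {h, h'}" and h: "h \<in> H" "h' \<in> H"
        and adj: "adjacent h h'" unfolding adjacent_pairs_def by blast
      show "e \<in> ?R"
        using h adj unfolding e H_def
        by (elim UnE imageE) (simp_all add: tri_adjacent, auto simp: insert_commute)
    qed
  next
    have "{h, h'} \<in> ?L" if "h \<in> H" "h' \<in> H" "adjacent h h'" for h h'
      using that unfolding adjacent_pairs_def by blast
    note I = this
    have mem: "tri_c i \<in> H" "tri_u i \<in> H" "tri_w i \<in> H" "tri_b i \<in> H" if "i \<in> {1..n}" for i
      using that by (auto simp: H_def)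
    have "{{tri_c i, tri_u i}, {tri_c i, tri_w i}, {tri_c i, tri_b i}} \<subseteq> ?L"
      if "i \<in> {1..n}" for i
      using I mem[OF that] by (simp add: tri_adjacent)
    moreover have "{tri_w i, tri_u (i + 1)} \<in> ?L" if "i \<in> {1..<n}" for i
      using that by (intro I mem) (auto simp: tri_adjacent)
    ultimately show "?R \<subseteq> ?L" by blast
  qed
  ultimately show ?thesis unfolding triphenylene_chain_def H_def by blast
qed

end

theory Submission
  imports Defs
begin

text \<open>A spanning tree is a connected spanning set of edges with one edge fewer than there are vertices.
In this form the number of spanning trees obeys deletion and contraction, and this is all that is
used about trees.

Both chains are grown hexagon by hexagon. Attaching a hexagon to a system \<open>K\<close> along one edge \<open>e\<close> adds
an ear of five edges. A spanning tree of the larger graph either misses exactly one of them and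
restricts to a spanning tree of \<open>K\<close>, or contains all of them and restricts to a spanning tree of \<open>K\<close>
with \<open>e\<close> contracted. Writing \<open>\<tau>\<close> for the number of spanning trees, this gives
\<open>\<tau>(K + h) = 6 \<tau>(K) - \<tau>(K - e)\<close> (lemma \<open>attach_hexagon\<close>). After the removal of an edge of the new
hexagon that no other hexagon has, the rest of its ear is pendant, so \<open>\<tau>(K + h - f) = \<tau>(K)\<close>; after
the removal of two such edges, nothing is left that spans.

In the pyrene chain the hexagons \<open>a\<^sub>i\<close> and \<open>b\<^sub>i\<close> each share two edges \<open>zx\<close> and \<open>zy\<close> with the rest, and
the common vertex \<open>z\<close> has one further edge \<open>zv\<close>. Expanding the three edges at \<open>z\<close> by deletion and
contraction shows that such a hexagon contributes
\<open>\<tau>(K + h) = 6 \<tau>(K) - 2 \<tau>(K - zx) - 2 \<tau>(K - zy) + \<tau>(K - zv)\<close> (lemma \<open>attach_in_corner\<close>). Behind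
these identities stands the determinant of \<open>6 I - A\<close>, where \<open>A\<close> is the adjacency matrix of the
hexagons: it is the number of spanning trees of the dual graph, and \<open>\<tau>(K - e)\<close> is its cofactor for the
hexagon of an outer edge \<open>e\<close>.

Let \<open>G\<close> be the graph of the first \<open>n\<close> units and \<open>g\<close> the edge along which the next unit is attached.
The pair \<open>(\<tau>(G), \<tau>(G - g))\<close> starts with \<open>(1, 0)\<close>, the values of a single edge \<open>g\<close>, and each unit maps
\<open>(A, B)\<close> to \<open>(1092 A - 204 B, 204 A - 36 B)\<close> for the pyrene chain and to
\<open>(1188 A - 204 B, 204 A - 35 B)\<close> for the triphenylene chain (lemmas \<open>pyrene_unit\<close> and
\<open>triphenylene_unit\<close>). In the triphenylene chain it does not matter which of the possible edges \<open>g\<close>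
is taken, which is why the positions of the fusions do not affect the result. The eigenvalues of
these two matrices are \<open>528 \<plusminus> 96 \<surd>30\<close> and \<open>(1153 \<plusminus> \<surd>1329265) / 2\<close>.\<close>

section \<open>Spanning trees through connectivity and cardinality\<close>

text \<open>Connectivity is handled through labellings of the vertices that do not change along edges: a graph
is connected iff every such labelling is constant. This replaces the construction of paths by the
construction of labellings, and it makes contraction a mere addition of a constraint.\<close>

definition constant_along :: "'a set set \<Rightarrow> ('a \<Rightarrow> 'b) \<Rightarrow> bool" where
  "constant_along S f \<longleftrightarrow> (\<forall>a b. {a, b} \<in> S \<longrightarrow> f a = f b)"

lemma constant_along_insert:
  "constant_along (insert {a, b} S) f \<longleftrightarrow> f a = f b \<and> constant_along S f"
  unfolding constant_along_def by (auto simp: doubleton_eq_iff)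

lemma constant_along_Un:
  "constant_along (S \<union> S') f \<longleftrightarrow> constant_along S f \<and> constant_along S' f"
  unfolding constant_along_def by blast

lemma constant_along_empty [simp]: "constant_along {} f"
  by (simp add: constant_along_def)

lemma constant_along_reachable:
  assumes "(x, y) \<in> {(a, b). a \<noteq> b \<and> {a, b} \<in> S}\<^sup>*" "constant_along S f"
  shows "f x = f y"
  using assms by (induction rule: rtrancl_induct) (auto simp: constant_along_def)

lemma graph_connected_constant:
  assumes "graph_connected V S" "constant_along S f" "x \<in> V" "y \<in> V"
  shows "f x = f y"
  using assms by (auto simp: graph_connected_def intro: constant_along_reachable)

lemma graph_connected_iff:
  fixes V :: "'a set"
  shows "graph_connected V S \<longleftrightarrow>
    V \<noteq> {} \<and> (\<forall>f :: 'a \<Rightarrow> bool. constant_along S f \<longrightarrow> (\<forall>x\<in>V. \<forall>y\<in>V. f x = f y))"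
    (is "?L \<longleftrightarrow> ?R")
proof
  assume L: ?L
  then show ?R
    using graph_connected_constant[OF L] unfolding graph_connected_def by blast
next
  let ?r = "{(a, b). a \<noteq> b \<and> {a, b} \<in> S}"
  assume R: ?R
  have "(x, y) \<in> ?r\<^sup>*" if xy: "x \<in> V" "y \<in> V" for x y
  proof -
    have step: "(x, a) \<in> ?r\<^sup>* \<Longrightarrow> {a, b} \<in> S \<Longrightarrow> (x, b) \<in> ?r\<^sup>*" for a b
      by (cases "a = b") (auto intro: rtrancl_into_rtrancl)
    \<comment> \<open>The label of a vertex tells whether it can be reached from \<open>x\<close>.\<close>
    have "constant_along S (\<lambda>v. (x, v) \<in> ?r\<^sup>*)"
      unfolding constant_along_def
    proof (intro allI impI)
      fix a b assume ab: "{a, b} \<in> S"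
      then have "{b, a} \<in> S" by (simp add: insert_commute)
      then show "((x, a) \<in> ?r\<^sup>*) = ((x, b) \<in> ?r\<^sup>*)" using ab step by blast
    qed
    with R xy have "((x, x) \<in> ?r\<^sup>*) = ((x, y) \<in> ?r\<^sup>*)" by blast
    then show ?thesis by simp
  qed
  with R show ?L by (auto simp: graph_connected_def)
qed

text \<open>Label every vertex by itself and process the edges one by one: an edge identifies at most two
labels, and in the end a single label is left.\<close>

lemma connected_card_bound:
  assumes "finite V" "finite S" "graph_connected V S" "\<And>e. e \<in> S \<Longrightarrow> \<exists>a b. e = {a, b}"
  shows "card V \<le> card S + 1"
proof -
  have "\<exists>f :: 'a \<Rightarrow> 'a. constant_along S f \<and> card V \<le> card (f ` V) + card S"
    using assms(2,4)
  proof (induction S)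
    case empty
    show ?case by (intro exI[of _ id]) simp
  next
    case (insert e S)
    then obtain f :: "'a \<Rightarrow> 'a" where f: "constant_along S f" "card V \<le> card (f ` V) + card S"
      by auto
    obtain a b where e: "e = {a, b}" using insert.prems by blast
    let ?g = "\<lambda>v. if f v = f b then f a else f v"
    have "constant_along (insert e S) ?g"
      using f(1) unfolding e constant_along_insert by (auto simp: constant_along_def)
    moreover have "card V \<le> card (?g ` V) + card (insert e S)"
    proof -
      have "f ` V \<subseteq> insert (f b) (?g ` V)" by auto
      then have "card (f ` V) \<le> card (insert (f b) (?g ` V))"
        by (intro card_mono) (auto simp: assms(1))
      also have "\<dots> \<le> Suc (card (?g ` V))" by (simp add: card_insert_if assms(1))
      finally show ?thesis using f(2) insert.hyps by simp
    qed
    ultimately show ?case by blast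
  qed
  then obtain f :: "'a \<Rightarrow> 'a" where f: "constant_along S f" "card V \<le> card (f ` V) + card S"
    by blast
  obtain x where "x \<in> V" using assms(3) by (auto simp: graph_connected_def)
  then have "f ` V \<subseteq> {f x}" using graph_connected_constant[OF assms(3) f(1)] by blast
  then have "card (f ` V) \<le> 1" by (metis card_mono card.empty card_insert_if empty_iff finite.emptyI finite.insertI One_nat_def)
  with f(2) show ?thesis by simp
qed

lemma reachable_simple_path:
  assumes "(x, y) \<in> {(a, b). a \<noteq> b \<and> {a, b} \<in> S}\<^sup>*"
  shows "\<exists>p. p \<noteq> [] \<and> distinct p \<and> hd p = x \<and> last p = y \<and>
    (\<forall>i. Suc i < length p \<longrightarrow> {p ! i, p ! Suc i} \<in> S)"
  using assms
proof (induction rule: rtrancl_induct)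
  case base
  show ?case by (intro exI[of _ "[x]"]) simp
next
  case (step y z)
  then obtain p where p: "p \<noteq> []" "distinct p" "hd p = x" "last p = y"
    "\<And>i. Suc i < length p \<Longrightarrow> {p ! i, p ! Suc i} \<in> S" by auto
  show ?case
  proof (cases "z \<in> set p")
    case True
    then obtain k where k: "k < length p" "p ! k = z" by (metis in_set_conv_nth)
    show ?thesis
      using p k by (intro exI[of _ "take (Suc k) p"])
        (auto simp: last_conv_nth hd_conv_nth)
  next
    case False
    have "{(p @ [z]) ! i, (p @ [z]) ! Suc i} \<in> S" if "Suc i < length (p @ [z])" for i
    proof (cases "Suc i < length p")
      case True
      then show ?thesis using p(5)[of i] by (simp add: nth_append)
    next
      case False
      then have "i = length p - 1" "i < length p" using that by auto
      then show ?thesis using p(1,4) step.hyps(2) by (auto simp: nth_append last_conv_nth)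
    qed
    then show ?thesis using p False by (intro exI[of _ "p @ [z]"]) auto
  qed
qed

text \<open>Kruskal's algorithm: of the edges, keep those that identify two different labels. Each edge kept
lowers the number of labels by exactly one, and two vertices get the same label only if the edges
kept join them.\<close>

lemma connected_spanning_subset:
  assumes "finite V" "graph_connected V S" "finite S" "\<And>e. e \<in> S \<Longrightarrow> \<exists>a b. e = {a, b} \<and> a \<in> V \<and> b \<in> V"
  shows "\<exists>T\<subseteq>S. card T + 1 = card V \<and> (\<forall>x\<in>V. \<forall>y\<in>V. (x, y) \<in> {(a, b). a \<noteq> b \<and> {a, b} \<in> T}\<^sup>*)"
proof -
  define R where "R T = {(a, b). a \<noteq> b \<and> {a, b} \<in> T}\<^sup>*" for T :: "'a set set"
  have R_sym: "(x, y) \<in> R T \<Longrightarrow> (y, x) \<in> R T" for x y T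
    unfolding R_def by (rule symD[OF sym_rtrancl]) (auto simp: sym_def insert_commute)
  have R_trans: "(x, y) \<in> R T \<Longrightarrow> (y, z) \<in> R T \<Longrightarrow> (x, z) \<in> R T" for x y z T
    unfolding R_def by (rule rtrancl_trans)
  have R_mono: "(x, y) \<in> R T \<Longrightarrow> (x, y) \<in> R (insert e T)" for x y e T
    unfolding R_def by (erule rtrancl_mono[THEN subsetD, rotated]) auto
  have "\<exists>T\<subseteq>S. \<exists>f :: 'a \<Rightarrow> 'a. constant_along S f \<and> card (f ` V) + card T = card V \<and>
      (\<forall>x\<in>V. \<forall>y\<in>V. f x = f y \<longrightarrow> (x, y) \<in> R T)"
    using assms(3,4)
  proof (induction S)
    case empty
    show ?case by (intro exI[of _ "{}"] conjI exI[of _ id]) (auto simp: R_def)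
  next
    case (insert e S)
    then obtain T and f :: "'a \<Rightarrow> 'a" where T: "T \<subseteq> S" "constant_along S f"
      "card (f ` V) + card T = card V" "\<And>x y. x \<in> V \<Longrightarrow> y \<in> V \<Longrightarrow> f x = f y \<Longrightarrow> (x, y) \<in> R T"
      by (auto simp: Ball_def)
    obtain a b where e: "e = {a, b}" and ab: "a \<in> V" "b \<in> V" using insert.prems by blast
    show ?case
    proof (cases "f a = f b")
      case True
      then have "constant_along (insert e S) f" using T(2) by (simp add: e constant_along_insert)
      then show ?thesis using T by (intro exI[of _ T] conjI exI[of _ f]) auto
    next
      case False
      let ?g = "\<lambda>v. if f v = f b then f a else f v"
      have 1: "constant_along (insert e S) ?g"
        using T(2) unfolding e constant_along_insert by (auto simp: constant_along_def)
      have "?g ` V = f ` V - {f b}" using False ab by auto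
      moreover have "card (f ` V - {f b}) + 1 = card (f ` V)"
        using ab assms(1) card_Suc_Diff1[of "f ` V" "f b"] by (simp only: Suc_eq_plus1 finite_imageI imageI)
      moreover have "card (insert e T) = Suc (card T)"
        using T(1) insert.hyps finite_subset by (subst card_insert_disjoint) auto
      ultimately have 2: "card (?g ` V) + card (insert e T) = card V" using T(3) by simp
      have eR: "(a, b) \<in> R (insert e T)"
        unfolding R_def e using False by (intro r_into_rtrancl) auto
      have "(x, y) \<in> R (insert e T)" if "x \<in> V" "y \<in> V" and g: "?g x = ?g y" for x y
      proof -
        consider "f x = f y" | "f x = f b" "f y = f a" | "f x = f a" "f y = f b"
          using g by (cases "f x = f b"; cases "f y = f b") simp_all
        then show ?thesis
        proof cases
          case 1
          then show ?thesis using T(4) that R_mono by blast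
        next
          case 2
          then have "(x, b) \<in> R (insert e T)" "(a, y) \<in> R (insert e T)"
            using T(4) that ab R_mono by auto
          then show ?thesis using eR R_sym R_trans by blast
        next
          case 3
          then have "(x, a) \<in> R (insert e T)" "(b, y) \<in> R (insert e T)"
            using T(4) that ab R_mono by auto
          then show ?thesis using eR R_trans by blast
        qed
      qed
      then show ?thesis using 1 2 T(1) by (intro exI[of _ "insert e T"] conjI exI[of _ ?g]) auto
    qed
  qed
  then obtain T and f :: "'a \<Rightarrow> 'a" where T: "T \<subseteq> S" "constant_along S f"
    "card (f ` V) + card T = card V" "\<And>x y. x \<in> V \<Longrightarrow> y \<in> V \<Longrightarrow> f x = f y \<Longrightarrow> (x, y) \<in> R T"
    by blast
  have fV: "f x = f y" if "x \<in> V" "y \<in> V" for x y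
    using graph_connected_constant[OF assms(2) T(2) that] .
  obtain x where "x \<in> V" using assms(2) by (auto simp: graph_connected_def)
  then have "f ` V = {f x}" using fV by blast
  then have "card T + 1 = card V" using T(3) by simp
  then show ?thesis using T(1,4) fV unfolding R_def by blast
qed

text \<open>An acyclic connected set equals its Kruskal subset, because any further edge would close a cycle
with a path of that subset. Conversely, one edge of a cycle can be dropped without losing
connectivity, which the lower bound on the number of edges forbids.\<close>

lemma spanning_trees_eq:
  assumes "finite V" "finite E" "\<And>e. e \<in> E \<Longrightarrow> \<exists>a b. e = {a, b} \<and> a \<noteq> b \<and> a \<in> V \<and> b \<in> V"
  shows "spanning_trees V E = {F. F \<subseteq> E \<and> graph_connected V F \<and> card F + 1 = card V}"
proof -
  have "(\<nexists>p. graph_cycle F p) \<longleftrightarrow> card F + 1 = card V" if F: "F \<subseteq> E" "graph_connected V F" for F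
  proof
    have fin: "finite F" using F(1) assms(2) finite_subset by blast
    assume acyclic: "\<nexists>p. graph_cycle F p"
    have "\<exists>a b. e = {a, b} \<and> a \<in> V \<and> b \<in> V" if "e \<in> F" for e
      using assms(3)[of e] F(1) that by blast
    then obtain T where T: "T \<subseteq> F" "card T + 1 = card V"
      "\<And>x y. x \<in> V \<Longrightarrow> y \<in> V \<Longrightarrow> (x, y) \<in> {(a, b). a \<noteq> b \<and> {a, b} \<in> T}\<^sup>*"
      using connected_spanning_subset[OF assms(1) F(2) fin] by blast
    have "F \<subseteq> T"
    proof (rule ccontr)
      assume "\<not> F \<subseteq> T"
      then obtain e where e: "e \<in> F" "e \<notin> T" by blast
      then obtain a b where ab: "e = {a, b}" "a \<noteq> b" "a \<in> V" "b \<in> V"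
        using F(1) assms(3) by blast
      obtain p where p: "p \<noteq> []" "distinct p" "hd p = a" "last p = b"
          "\<And>i. Suc i < length p \<Longrightarrow> {p ! i, p ! Suc i} \<in> T"
        using reachable_simple_path[OF T(3)[OF ab(3,4)]] by blast
      have "length p \<noteq> 1" using p(1,3,4) ab(2) by (auto simp: length_Suc_conv)
      moreover have "length p \<noteq> 2"
      proof
        assume "length p = 2"
        then have "p = [a, b]" using p(3,4) by (auto simp: length_Suc_conv numeral_2_eq_2)
        then show False using p(5)[of 0] e(2) ab(1) by simp
      qed
      moreover have "length p \<noteq> 0" using p(1) by simp
      ultimately have len: "3 \<le> length p" by linarith
      have "{p ! i, p ! (Suc i mod length p)} \<in> F" if "i < length p" for i
      proof (cases "Suc i < length p")
        case True
        then show ?thesis using p(5) T(1) by auto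
      next
        case False
        then have "i = length p - 1" "Suc i = length p" using that by auto
        then show ?thesis using p(1,3,4) e(1) ab(1)
          by (simp add: last_conv_nth hd_conv_nth insert_commute)
      qed
      then have "graph_cycle F p" using len p(2) by (simp add: graph_cycle_def)
      then show False using acyclic by blast
    qed
    then show "card F + 1 = card V" using T by auto
  next
    have fin: "finite F" using F(1) assms(2) finite_subset by blast
    assume card: "card F + 1 = card V"
    show "\<nexists>p. graph_cycle F p"
    proof
      assume "\<exists>p. graph_cycle F p"
      then obtain p where p: "3 \<le> length p" "distinct p"
        "\<And>i. i < length p \<Longrightarrow> {p ! i, p ! (Suc i mod length p)} \<in> F"
        by (auto simp: graph_cycle_def)
      let ?m = "length p - 1"
      let ?e = "{p ! 0, p ! ?m}"
      have "Suc ?m mod length p = 0" using p(1) by (cases p) auto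
      then have e: "?e \<in> F" using p(1) p(3)[of ?m] by (simp add: insert_commute)
      have "graph_connected V (F - {?e})"
        unfolding graph_connected_iff
      proof (intro conjI allI impI)
        show "V \<noteq> {}" using F(2) by (simp add: graph_connected_def)
        fix f :: "'a \<Rightarrow> bool" assume f: "constant_along (F - {?e}) f"
        have "i < length p \<Longrightarrow> f (p ! i) = f (p ! 0)" for i
        proof (induction i)
          case (Suc i)
          have "{p ! i, p ! Suc i} \<noteq> ?e"
          proof
            assume "{p ! i, p ! Suc i} = ?e"
            then have "p ! Suc i = p ! ?m \<and> p ! i = p ! 0 \<or> p ! Suc i = p ! 0"
              by (auto simp: doubleton_eq_iff)
            moreover have "0 < length p" "?m < length p" "i < length p" using p(1) Suc.prems by linarith+
            ultimately have "Suc i = ?m \<and> i = 0 \<or> Suc i = 0"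
              using p(2) Suc.prems nth_eq_iff_index_eq by metis
            then show False using p(1) by auto
          qed
          moreover have "{p ! i, p ! Suc i} \<in> F" using p(3)[of i] Suc.prems by simp
          ultimately have "f (p ! i) = f (p ! Suc i)" using f by (auto simp: constant_along_def)
          then show ?case using Suc by simp
        qed simp
        then have "f (p ! 0) = f (p ! ?m)" using p(1) by simp
        then have "constant_along F f"
          using f constant_along_insert[of "p ! 0" "p ! ?m" "F - {?e}" f] e
          by (simp add: insert_absorb)
        then show "\<forall>x\<in>V. \<forall>y\<in>V. f x = f y" using graph_connected_constant[OF F(2)] by blast
      qed
      moreover have "\<exists>a b. d = {a, b}" if "d \<in> F - {?e}" for d
        using that F(1) assms(3)[of d] by blast
      ultimately have "card V \<le> card (F - {?e}) + 1"
        using fin by (intro connected_card_bound assms(1)) simp_all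
      moreover have "card (F - {?e}) < card F" by (rule card_Diff1_less[OF fin e])
      ultimately show False using card by simp
    qed
  qed
  then show ?thesis unfolding spanning_trees_def by blast
qed

section \<open>Deletion and contraction\<close>

text \<open>This is the number of spanning trees of the multigraph obtained from \<open>(V, E)\<close> by contracting the
edges in \<open>C\<close>. No quotient of \<open>V\<close> is formed: the edges in \<open>C\<close> are forced into the tree and counted
separately from those chosen from \<open>E\<close>. Thus an edge in \<open>E \<inter> C\<close> behaves like a second edge parallel to
the contracted one, that is, like a loop, and the number is \<open>0\<close> if \<open>C\<close> contains a cycle.\<close>

definition tree_extensions :: "'a set \<Rightarrow> 'a set set \<Rightarrow> 'a set set \<Rightarrow> nat" where
  "tree_extensions V E C =
     card {F. F \<subseteq> E \<and> graph_connected V (F \<union> C) \<and> card F + card C + 1 = card V}"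

text \<open>Sort the trees by whether they contain \<open>e\<close>.\<close>

lemma deletion_contraction:
  assumes "finite E" "finite C" "e \<notin> E" "e \<notin> C"
  shows "tree_extensions V (insert e E) C = tree_extensions V E C + tree_extensions V E (insert e C)"
proof -
  let ?A = "{F. F \<subseteq> E \<and> graph_connected V (F \<union> C) \<and> card F + card C + 1 = card V}"
  let ?B = "{F. F \<subseteq> E \<and> graph_connected V (F \<union> insert e C) \<and> card F + card (insert e C) + 1 = card V}"
  let ?L = "{F. F \<subseteq> insert e E \<and> graph_connected V (F \<union> C) \<and> card F + card C + 1 = card V}"
  have card_e: "card (insert e F) = Suc (card F)" if "F \<subseteq> E" for F
    using that assms(1,3) by (intro card_insert_disjoint) (auto intro: finite_subset)
  have card_C: "card (insert e C) = Suc (card C)" using assms(2,4) by simp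
  have "?L = ?A \<union> insert e ` ?B"
  proof (intro set_eqI iffI)
    fix F assume F: "F \<in> ?L"
    show "F \<in> ?A \<union> insert e ` ?B"
    proof (cases "e \<in> F")
      case True
      have 1: "F - {e} \<subseteq> E" using F by auto
      have 2: "F = insert e (F - {e})" using True by auto
      have 3: "F - {e} \<union> insert e C = F \<union> C" using True by auto
      have "card F = Suc (card (F - {e}))" using card_e[OF 1] 2 by simp
      then have "F - {e} \<in> ?B" using F 1 unfolding mem_Collect_eq 3 card_C by simp
      then show ?thesis using 2 by blast
    next
      case False
      then show ?thesis using F by auto
    qed
  next
    fix F assume "F \<in> ?A \<union> insert e ` ?B"
    then show "F \<in> ?L"
    proof
      assume "F \<in> ?A" then show ?thesis by auto
    next
      assume "F \<in> insert e ` ?B"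
      then obtain F' where F': "F = insert e F'" "F' \<in> ?B" by blast
      have "F \<union> C = F' \<union> insert e C" using F'(1) by auto
      then show ?thesis using F' card_e[of F'] card_C by auto
    qed
  qed
  moreover have "?A \<inter> insert e ` ?B = {}" using assms(3) by blast
  moreover have "inj_on (insert e) ?B"
    using assms(3) by (intro inj_onI) (metis (mono_tags, lifting) insert_ident mem_Collect_eq subsetD)
  moreover have "finite ?A" "finite ?B" using assms(1) by auto
  ultimately show ?thesis
    unfolding tree_extensions_def by (simp add: card_Un_disjoint card_image)
qed

text \<open>Contracted edges matter only through the connections that they make and through their number. This
allows a contracted pair of edges \<open>px, py\<close> to be replaced by \<open>px, xy\<close>.\<close>

lemma tree_extensions_cong:
  assumes "\<And>f :: 'a \<Rightarrow> bool. constant_along C f \<longleftrightarrow> constant_along C' f" "card C = card C'"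
  shows "tree_extensions (V :: 'a set) E C = tree_extensions V E C'"
  unfolding tree_extensions_def graph_connected_iff constant_along_Un assms ..

text \<open>The edge \<open>xy\<close> has become a loop: a set containing it would still be connected without it and would
then have too few edges.\<close>

lemma tree_extensions_parallel:
  fixes V :: "'a set"
  assumes "\<And>f :: 'a \<Rightarrow> bool. constant_along C f \<Longrightarrow> f x = f y" "{x, y} \<notin> E"
    and fin: "finite V" "finite E" "finite C"
    and two: "\<And>e. e \<in> E \<union> C \<Longrightarrow> \<exists>a b. e = {a, b}"
  shows "tree_extensions V (insert {x, y} E) C = tree_extensions V E C"
proof -
  have "{x, y} \<notin> F" if F: "F \<subseteq> insert {x, y} E" "graph_connected V (F \<union> C)"
    "card F + card C + 1 = card V" for F
  proof
    assume xy: "{x, y} \<in> F"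
    let ?F = "F - {{x, y}}"
    have "constant_along (F \<union> C) f \<longleftrightarrow> constant_along (?F \<union> C) f" for f :: "'a \<Rightarrow> bool"
      using assms(1)[of f] constant_along_insert[of x y ?F f] xy
      by (auto simp: constant_along_Un insert_absorb)
    then have conn: "graph_connected V (?F \<union> C)" using F(2) unfolding graph_connected_iff by blast
    have finF: "finite F" using F(1) fin(2) finite_subset by blast
    have "\<exists>a b. e = {a, b}" if "e \<in> ?F \<union> C" for e using that F(1) two by blast
    then have "card V \<le> card (?F \<union> C) + 1"
      using connected_card_bound[OF fin(1) _ conn] finF fin(3) by simp
    also have "\<dots> \<le> card ?F + card C + 1" using card_Un_le by simp
    also have "\<dots> < card F + card C + 1" using card_Diff1_less[OF finF xy] by simp
    finally show False using F(3) by simp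
  qed
  then have "{F. F \<subseteq> insert {x, y} E \<and> graph_connected V (F \<union> C) \<and> card F + card C + 1 = card V} =
    {F. F \<subseteq> E \<and> graph_connected V (F \<union> C) \<and> card F + card C + 1 = card V}"
    by blast
  then show ?thesis unfolding tree_extensions_def by simp
qed

text \<open>Contracting all edges of a cycle uses up one edge more than it saves in components.\<close>

lemma tree_extensions_cyclic:
  fixes V :: "'a set"
  assumes "\<And>f :: 'a \<Rightarrow> bool. constant_along C f \<Longrightarrow> f x = f y" "{x, y} \<notin> C"
    and fin: "finite V" "finite E" "finite C"
    and two: "\<And>e. e \<in> E \<union> C \<Longrightarrow> \<exists>a b. e = {a, b}"
  shows "tree_extensions V E (insert {x, y} C) = 0"
proof -
  have "False" if F: "F \<subseteq> E" "graph_connected V (F \<union> insert {x, y} C)"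
    "card F + card (insert {x, y} C) + 1 = card V" for F
  proof -
    have "constant_along (F \<union> insert {x, y} C) f \<longleftrightarrow> constant_along (F \<union> C) f" for f :: "'a \<Rightarrow> bool"
      using assms(1)[of f] by (auto simp: constant_along_Un constant_along_insert)
    then have conn: "graph_connected V (F \<union> C)" using F(2) unfolding graph_connected_iff by blast
    have finF: "finite F" using F(1) fin(2) finite_subset by blast
    have "\<exists>a b. e = {a, b}" if "e \<in> F \<union> C" for e using that F(1) two by blast
    then have "card V \<le> card (F \<union> C) + 1"
      using connected_card_bound[OF fin(1) _ conn] finF fin(3) by simp
    also have "\<dots> \<le> card F + card C + 1" using card_Un_le by simp
    finally show False using F(3) assms(2) fin(3) by simp
  qed
  then show ?thesis unfolding tree_extensions_def by (simp add: card_eq_0_iff) blast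
qed

lemma tree_extensions_isolated:
  fixes V :: "'a set"
  assumes "p \<in> V" "x \<in> V" "x \<noteq> p" "\<And>e. e \<in> E \<union> C \<Longrightarrow> p \<notin> e"
  shows "tree_extensions V E C = 0"
proof -
  have "\<not> graph_connected V (F \<union> C)" if "F \<subseteq> E" for F
  proof
    assume conn: "graph_connected V (F \<union> C)"
    have "constant_along (F \<union> C) (\<lambda>v. v = p)"
      unfolding constant_along_def using assms(4) that by blast
    from graph_connected_constant[OF conn this assms(1,2)] assms(3) show False by simp
  qed
  then show ?thesis unfolding tree_extensions_def by (simp add: card_eq_0_iff) blast
qed

text \<open>If the edge \<open>px\<close> is contracted and \<open>p\<close> has no other edge, then \<open>p\<close> always carries the label of \<open>x\<close>
and may be left out.\<close>

lemma tree_extensions_absorb: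
  fixes V :: "'a set"
  assumes "p \<notin> V" "x \<in> V" "\<And>e. e \<in> E \<union> C \<Longrightarrow> p \<notin> e" "finite V" "finite C"
  shows "tree_extensions (insert p V) E (insert {p, x} C) = tree_extensions V E C"
proof -
  have "graph_connected (insert p V) (F \<union> insert {p, x} C) \<longleftrightarrow> graph_connected V (F \<union> C)"
    if "F \<subseteq> E" for F
  proof
    assume L: "graph_connected (insert p V) (F \<union> insert {p, x} C)"
    show "graph_connected V (F \<union> C)" unfolding graph_connected_iff
    proof (intro conjI allI impI)
      show "V \<noteq> {}" using assms(2) by blast
      fix f :: "'a \<Rightarrow> bool" assume f: "constant_along (F \<union> C) f"
      \<comment> \<open>Outside \<open>V\<close>, the labelling has to be adapted so that it is constant along \<open>px\<close> too.\<close>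
      let ?g = "f(p := f x)"
      have "constant_along (F \<union> C) ?g"
        unfolding constant_along_def
      proof (intro allI impI)
        fix a b assume ab: "{a, b} \<in> F \<union> C"
        then have "p \<notin> {a, b}" using assms(3) that by blast
        then show "?g a = ?g b" using f ab by (auto simp: constant_along_def)
      qed
      then have g: "constant_along (F \<union> insert {p, x} C) ?g"
        using assms(1,2) by (auto simp: constant_along_Un constant_along_insert)
      show "\<forall>a\<in>V. \<forall>b\<in>V. f a = f b"
      proof (intro ballI)
        fix a b assume ab: "a \<in> V" "b \<in> V"
        then have "?g a = ?g b" by (intro graph_connected_constant[OF L g]) simp_all
        moreover have "a \<noteq> p" "b \<noteq> p" using ab assms(1) by auto
        ultimately show "f a = f b" by simp
      qed
    qed
  next
    assume R: "graph_connected V (F \<union> C)"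
    show "graph_connected (insert p V) (F \<union> insert {p, x} C)" unfolding graph_connected_iff
    proof (intro conjI allI impI)
      fix f :: "'a \<Rightarrow> bool" assume f: "constant_along (F \<union> insert {p, x} C) f"
      then have *: "f p = f x" "constant_along (F \<union> C) f"
        by (auto simp: constant_along_Un constant_along_insert)
      have "f a = f x" if "a \<in> insert p V" for a
        using that *(1) graph_connected_constant[OF R *(2) _ assms(2)] by blast
      then show "\<forall>a\<in>insert p V. \<forall>b\<in>insert p V. f a = f b" by blast
    qed simp
  qed
  moreover have "card (insert {p, x} C) = Suc (card C)"
    using assms(3,5) by (intro card_insert_disjoint) auto
  moreover have "card (insert p V) = Suc (card V)" using assms(1,4) by simp
  ultimately show ?thesis unfolding tree_extensions_def
    by (metis (no_types, lifting) add_Suc add_Suc_right add_diff_cancel_left' plus_1_eq_Suc)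
qed

lemma tree_extensions_pendant:
  fixes V :: "'a set"
  assumes "p \<notin> V" "x \<in> V" "\<And>e. e \<in> E \<union> C \<Longrightarrow> p \<notin> e" "finite V" "finite E" "finite C"
  shows "tree_extensions (insert p V) (insert {p, x} E) C = tree_extensions V E C"
proof -
  have "{p, x} \<notin> E" "{p, x} \<notin> C" "x \<noteq> p" using assms by blast+
  then show ?thesis
    using deletion_contraction[of E C "{p, x}" "insert p V"] assms
      tree_extensions_isolated[of p "insert p V" x E C] tree_extensions_absorb[OF assms(1-4) assms(6)]
    by simp
qed

section \<open>Attaching an ear\<close>

fun path_edges :: "'a list \<Rightarrow> 'a set set" where
  "path_edges (x # y # zs) = insert {x, y} (path_edges (y # zs))"
| "path_edges _ = {}"

lemma path_edges_subset: "e \<in> path_edges p \<Longrightarrow> e \<subseteq> set p"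
  by (induction p rule: path_edges.induct) auto

lemma finite_path_edges: "finite (path_edges p)"
  by (induction p rule: path_edges.induct) auto

text \<open>Let \<open>Q\<close> consist of some edges of an ear from \<open>x\<close> to \<open>y\<close> with new inner vertices \<open>ps\<close>. If the ear is
complete, a tree either misses one of its edges or contains it entirely and then treats it as the
contracted edge \<open>xy\<close>. If one edge of the ear is missing, the other edges are pendant; if two are
missing, the vertices between them are cut off.

The induction peels off the first edge of the ear. Its new end \<open>p\<close> joins the base graph: as a
pendant vertex, from which the remaining ear starts, or as an isolated vertex if the edge is
missing.\<close>

lemma tree_extensions_ear:
  assumes "finite V" "finite E" "x \<in> V" "y \<in> V" "x \<noteq> y" "distinct ps" "set ps \<inter> V = {}"
    and "\<And>e. e \<in> E \<Longrightarrow> e \<subseteq> V" "ps = [] \<Longrightarrow> {x, y} \<notin> E" "Q \<subseteq> path_edges (x # ps @ [y])"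
  shows "tree_extensions (V \<union> set ps) (E \<union> Q) {} =
    (if Q = path_edges (x # ps @ [y])
     then (length ps + 1) * tree_extensions V E {} + tree_extensions V E {{x, y}}
     else if card (path_edges (x # ps @ [y]) - Q) = 1 then tree_extensions V E {} else 0)"
  using assms
proof (induction ps arbitrary: V E x Q)
  case Nil
  show ?case
  proof (cases "Q = {}")
    case False
    then have "Q = {{x, y}}" using Nil.prems(10) by auto
    then show ?thesis using deletion_contraction[of E "{}" "{x, y}" V] Nil.prems by simp
  qed simp
next
  case (Cons p ps)
  let ?N = "tree_extensions"
  let ?V1 = "insert p V" and ?P = "path_edges (p # ps @ [y])"
  have p: "p \<notin> V" "p \<noteq> x" "p \<noteq> y" using Cons.prems(3,4,7) by auto
  have pE: "e \<in> E \<Longrightarrow> p \<notin> e" for e using Cons.prems(8) p(1) by blast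
  have path: "path_edges (x # (p # ps) @ [y]) = insert {x, p} ?P" by simp
  have xpP: "{x, p} \<notin> ?P"
  proof
    assume "{x, p} \<in> ?P"
    then have "x \<in> set (p # ps @ [y])" using path_edges_subset by blast
    then show False using Cons.prems(3,5,7) by auto
  qed
  have VV: "V \<union> set (p # ps) = ?V1 \<union> set ps" by simp
  have contract: "?N ?V1 E {{p, y}} = ?N V E {}"
    using tree_extensions_absorb[of p V y E "{}"] p pE Cons.prems(1,4) by auto
  show ?case
  proof (cases "{x, p} \<in> Q")
    case True
    let ?Q = "Q - {{x, p}}" and ?E1 = "insert {p, x} E"
    have Q: "E \<union> Q = ?E1 \<union> ?Q" using True by (auto simp: insert_commute)
    have py: "{p, y} \<notin> ?E1" using pE Cons.prems(5) p by (auto simp: doubleton_eq_iff)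
    have "?N (?V1 \<union> set ps) (?E1 \<union> ?Q) {} = (if ?Q = ?P
        then (length ps + 1) * ?N ?V1 ?E1 {} + ?N ?V1 ?E1 {{p, y}}
        else if card (?P - ?Q) = 1 then ?N ?V1 ?E1 {} else 0)"
      using Cons.prems p py by (intro Cons.IH) auto
    moreover have "?N ?V1 ?E1 {} = ?N V E {}"
      using tree_extensions_pendant[of p V x E "{}"] p pE Cons.prems by simp
    moreover have "?N ?V1 ?E1 {{p, y}} = ?N V E {} + ?N V E {{x, y}}"
    proof -
      have "?N ?V1 ?E1 {{p, y}} = ?N ?V1 E {{p, y}} + ?N ?V1 E {{p, x}, {p, y}}"
        using py pE Cons.prems(2) p Cons.prems(5)
        by (subst deletion_contraction) (auto simp: doubleton_eq_iff)
      also have "?N ?V1 E {{p, x}, {p, y}} = ?N ?V1 E {{p, x}, {x, y}}"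
        using p Cons.prems(5)
        by (intro tree_extensions_cong) (auto simp: constant_along_insert doubleton_eq_iff)
      also have "\<dots> = ?N V E {{x, y}}"
        using tree_extensions_absorb[of p V x E "{{x, y}}"] p pE Cons.prems(1,3) by auto
      finally show ?thesis using contract by simp
    qed
    moreover have "Q = insert {x, p} ?P \<longleftrightarrow> ?Q = ?P" using True xpP by blast
    moreover have "insert {x, p} ?P - Q = ?P - ?Q" using True xpP by blast
    ultimately show ?thesis unfolding VV Q path by simp
  next
    case False
    then have Q: "Q \<subseteq> ?P" using Cons.prems(10) by auto
    have "?N (?V1 \<union> set ps) (E \<union> Q) {} = (if Q = ?P
        then (length ps + 1) * ?N ?V1 E {} + ?N ?V1 E {{p, y}}
        else if card (?P - Q) = 1 then ?N ?V1 E {} else 0)"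
      using Cons.prems p pE Q by (intro Cons.IH) auto
    moreover have "?N ?V1 E {} = 0"
      using pE p Cons.prems(3) by (intro tree_extensions_isolated[of p _ x]) auto
    moreover have "Q \<noteq> insert {x, p} ?P" using False by auto
    moreover have "insert {x, p} ?P - Q = insert {x, p} (?P - Q)" using False by auto
    then have "card (insert {x, p} ?P - Q) = Suc (card (?P - Q))"
      using xpP finite_path_edges[of "p # ps @ [y]"] by simp
    moreover have "card (?P - Q) = 0 \<longleftrightarrow> Q = ?P"
      using Q finite_path_edges[of "p # ps @ [y]"] by auto
    ultimately show ?thesis unfolding VV path using contract by simp
  qed
qed

text \<open>The vertex \<open>z\<close> has the three neighbours \<open>x, y, v\<close>. Deletion and contraction of the edges at \<open>z\<close>
express everything through the graph without \<open>z\<close>. Let \<open>M\<close> count its spanning trees, \<open>M\<^sub>x\<^sub>y\<close> those after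
contraction of \<open>xy\<close>, and so on, with \<open>q\<close> for the contraction of all three neighbours to one vertex. The
number of spanning trees is \<open>3 M + M\<^sub>x\<^sub>y + M\<^sub>x\<^sub>v + M\<^sub>y\<^sub>v + q\<close>, and after contraction of \<open>xy\<close> it is
\<open>3 M\<^sub>x\<^sub>y + 2 q\<close>. Without the edge \<open>zx\<close> the first number becomes \<open>2 M + M\<^sub>y\<^sub>v\<close>, and likewise for the other
two edges; the stated combination is then forced.\<close>

lemma tree_extensions_corner:
  fixes V :: "'a set"
  assumes z: "z \<notin> V" "\<And>e. e \<in> E \<Longrightarrow> z \<notin> e" and fin: "finite V" "finite E"
    and V: "x \<in> V" "y \<in> V" "v \<in> V" and ne: "x \<noteq> y" "x \<noteq> v" "y \<noteq> v"
    and two: "\<And>e. e \<in> E \<Longrightarrow> \<exists>a b. e = {a, b}"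
  defines "N \<equiv> \<lambda>S C. int (tree_extensions (insert z V) (S \<union> E) C)"
  shows "N {{z, x}, {z, y}, {z, v}} {{x, y}} = 2 * N {{z, x}, {z, y}, {z, v}} {}
      - 2 * N {{z, y}, {z, v}} {} - 2 * N {{z, x}, {z, v}} {} + N {{z, x}, {z, y}} {}"
    and "N {{z, x}, {z, y}} {{x, y}} = 2 * N {{z, x}, {z, y}} {} - 4 * N {{z, y}} {}"
proof -
  let ?M = "\<lambda>C. int (tree_extensions V E C)"
  have neq: "z \<noteq> x" "z \<noteq> y" "z \<noteq> v" using z(1) V by auto
  have zE: "{z, a} \<notin> E" for a using z(2) by blast
  have fresh: "z \<notin> e" if "e \<in> {{x, y}, {x, v}, {y, v}}" for e using that neq by auto
  have DC: "N (insert {z, a} S) C = N S C + N S (insert {z, a} C)"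
    if "finite S" "finite C" "{z, a} \<notin> S" "{z, a} \<notin> C" for a S C
    unfolding N_def using that zE[of a] fin(2) by (simp add: deletion_contraction)
  have iso: "N {} C = 0" if "\<forall>e\<in>C. z \<notin> e" for C
    unfolding N_def using z that V(1) neq by (auto intro!: tree_extensions_isolated[of z _ x])
  have absorb: "N {} (insert {z, a} C) = ?M C" if "a \<in> V" "\<And>e. e \<in> C \<Longrightarrow> z \<notin> e" "finite C" for a C
    unfolding N_def using that z fin(1) by (subst tree_extensions_absorb) auto
  have cong: "N {} C = N {} C'"
    if "\<And>f :: 'a \<Rightarrow> bool. constant_along C f \<longleftrightarrow> constant_along C' f" "card C = card C'" for C C'
    unfolding N_def using tree_extensions_cong[OF that] by simp
  have cyclic: "N {} (insert {a, b} C) = 0"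
    if "\<And>f :: 'a \<Rightarrow> bool. constant_along C f \<Longrightarrow> f a = f b" "{a, b} \<notin> C" "finite C"
      "\<And>e. e \<in> C \<Longrightarrow> \<exists>a b. e = {a, b}" for a b C
    unfolding N_def using that two fin by (simp, intro tree_extensions_cyclic) auto
  note dist = neq neq[symmetric] ne ne[symmetric]
  have one: "N {} {{z, a}} = ?M {}" if "a \<in> V" for a
    using absorb[of a "{}"] that by simp
  have pair: "N {} {{z, b}, {z, a}} = ?M {{a, b}}" "N {} {{z, a}, {z, b}} = ?M {{a, b}}"
    if "a \<in> V" "b \<in> V" "a \<noteq> b" for a b
  proof -
    have "a \<noteq> z" "b \<noteq> z" using that z(1) by auto
    then have "N {} {{z, a}, {z, b}} = N {} {{z, a}, {a, b}}"
      using that by (intro cong) (auto simp: constant_along_insert doubleton_eq_iff)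
    also have "\<dots> = ?M {{a, b}}" using that \<open>a \<noteq> z\<close> \<open>b \<noteq> z\<close> by (intro absorb) auto
    finally show "N {} {{z, a}, {z, b}} = ?M {{a, b}}" .
    then show "N {} {{z, b}, {z, a}} = ?M {{a, b}}" by (simp add: insert_commute)
  qed
  let ?q = "?M {{x, y}, {x, v}}"
  have triple: "N {} C = ?q"
    if "\<And>f :: 'a \<Rightarrow> bool. constant_along C f \<longleftrightarrow> f z = f x \<and> f x = f y \<and> f x = f v" "card C = 3" for C
  proof -
    have "N {} C = N {} {{z, x}, {x, y}, {x, v}}"
      using that dist by (intro cong) (auto simp: constant_along_insert doubleton_eq_iff)
    also have "\<dots> = ?q" using dist V by (intro absorb) auto
    finally show ?thesis .
  qed
  have single: "N {} {{z, a}, {x, y}} = ?M {{x, y}}" if "a \<in> V" for a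
    using that dist by (intro absorb) auto
  have one_edge: "N {{z, a}} {} = ?M {}" if "a \<in> V" for a
    using that by (simp add: DC iso one)
  have two_edges: "N {{z, a}, {z, b}} {} = 2 * ?M {} + ?M {{a, b}}"
    if "a \<in> V" "b \<in> V" "a \<noteq> b" for a b
  proof -
    have "a \<noteq> z" "b \<noteq> z" using that z(1) by auto
    then show ?thesis using that by (simp add: DC iso one pair doubleton_eq_iff)
  qed
  have three_edges: "N {{z, x}, {z, y}, {z, v}} {} =
      3 * ?M {} + ?M {{x, y}} + ?M {{x, v}} + ?M {{y, v}} + ?q"
  proof -
    have "N {} {{z, v}, {z, y}, {z, x}} = ?q"
      using dist by (intro triple) (auto simp: constant_along_insert doubleton_eq_iff)
    then show ?thesis using dist V by (simp add: DC doubleton_eq_iff iso one pair)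
  qed
  have two_forest: "N {{z, x}, {z, y}} {{x, y}} = 2 * ?M {{x, y}}"
  proof -
    have "N {} {{z, y}, {z, x}, {x, y}} = 0"
      using dist by (intro cyclic) (auto simp: constant_along_insert doubleton_eq_iff)
    then show ?thesis using dist V fresh by (simp add: DC doubleton_eq_iff iso single)
  qed
  have three_forest: "N {{z, x}, {z, y}, {z, v}} {{x, y}} = 3 * ?M {{x, y}} + 2 * ?q"
  proof -
    have "N {} {{z, y}, {z, x}, {x, y}} = 0"
      using dist by (intro cyclic) (auto simp: constant_along_insert doubleton_eq_iff)
    moreover have "N {} {{z, v}, {z, y}, {z, x}, {x, y}} = 0"
    proof -
      have "N {} (insert {z, y} {{z, v}, {z, x}, {x, y}}) = 0"
        using dist by (intro cyclic) (auto simp: constant_along_insert doubleton_eq_iff)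
      then show ?thesis by (simp add: insert_commute)
    qed
    moreover have "N {} {{z, v}, {z, x}, {x, y}} = ?q" "N {} {{z, v}, {z, y}, {x, y}} = ?q"
      using dist by (intro triple; auto simp: constant_along_insert doubleton_eq_iff)+
    ultimately show ?thesis using dist V fresh by (simp add: DC doubleton_eq_iff iso single)
  qed
  show "N {{z, x}, {z, y}, {z, v}} {{x, y}} = 2 * N {{z, x}, {z, y}, {z, v}} {}
      - 2 * N {{z, y}, {z, v}} {} - 2 * N {{z, x}, {z, v}} {} + N {{z, x}, {z, y}} {}"
    using V ne by (simp add: three_forest three_edges two_edges)
  show "N {{z, x}, {z, y}} {{x, y}} = 2 * N {{z, x}, {z, y}} {} - 4 * N {{z, y}} {}"
    using V ne by (simp add: two_forest two_edges one_edge)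
qed

section \<open>Attaching a hexagon\<close>

text \<open>The count is an integer since the identities for it involve differences.\<close>

definition trees_without :: "cell set \<Rightarrow> point set set \<Rightarrow> int" where
  "trees_without K D = int (tree_extensions (bz_verts K) (bz_edges K - D) {})"

lemma finite_hex_edges: "finite (hex_edges h)"
  by (cases h) (simp add: hex_edges_eq)

lemma hex_edge_ends: "e \<in> hex_edges h \<Longrightarrow> \<exists>a b. e = {a, b} \<and> a \<noteq> b"
  unfolding hex_edges_eq[of "fst h" "snd h", simplified]
  by (elim insertE emptyE) (rule exI, rule exI, rule conjI, assumption, simp)+

lemma hex_edge_subset: "e \<in> hex_edges h \<Longrightarrow> e \<subseteq> hex_verts h"
  unfolding hex_edges_eq[of "fst h" "snd h", simplified] hex_verts_eq[of "fst h" "snd h", simplified]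
  by (elim insertE emptyE) simp_all

lemma finite_bz_verts: "finite K \<Longrightarrow> finite (bz_verts K)"
  by (auto simp: bz_verts_def hex_verts_def)

lemma finite_bz_edges: "finite K \<Longrightarrow> finite (bz_edges K)"
  by (auto simp: bz_edges_def finite_hex_edges)

lemma bz_edge_subset: "e \<in> bz_edges K \<Longrightarrow> e \<subseteq> bz_verts K"
  unfolding bz_edges_def bz_verts_def using hex_edge_subset by blast

lemma bz_edge_ends: "e \<in> bz_edges K \<Longrightarrow> \<exists>a b. e = {a, b} \<and> a \<noteq> b"
  unfolding bz_edges_def using hex_edge_ends by blast

lemma num_spanning_trees_eq:
  assumes "finite K"
  shows "int (num_spanning_trees K) = trees_without K {}"
proof -
  have "\<exists>a b. e = {a, b} \<and> a \<noteq> b \<and> a \<in> bz_verts K \<and> b \<in> bz_verts K" if "e \<in> bz_edges K" for e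
    using bz_edge_ends[OF that] bz_edge_subset[OF that] by blast
  then show ?thesis
    unfolding num_spanning_trees_def trees_without_def tree_extensions_def
    by (subst spanning_trees_eq) (simp_all add: assms finite_bz_verts finite_bz_edges)
qed

text \<open>By rotation, each edge of a hexagon is closed by an ear that consists of the five others.\<close>

lemma hexagon_as_ear:
  assumes "e \<in> hex_edges h"
  obtains x y ps where "e = {x, y}" "x \<noteq> y" "distinct ps" "length ps = 4" "set ps \<inter> {x, y} = {}"
    "hex_verts h = {x, y} \<union> set ps" "path_edges (x # ps @ [y]) = hex_edges h - {e}"
    "card (hex_edges h - {e}) = 5"
proof -
  note result = that
  obtain A B C D E F where dist: "distinct [A, B, C, D, E, F]"
    and verts: "hex_verts h = {A, B, C, D, E, F}"
    and edges: "hex_edges h = {{A, B}, {B, C}, {C, D}, {D, E}, {E, F}, {F, A}}"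
  proof -
    obtain q r where h: "h = (q, r)" by fastforce
    show ?thesis by (rule that) (simp_all only: h hex_verts_eq hex_edges_eq, simp)
  qed
  have *: ?thesis if "e = {x, y}" "distinct [x, a, b, c, d, y]" "hex_verts h = {x, a, b, c, d, y}"
    "hex_edges h = insert {x, y} {{x, a}, {a, b}, {b, c}, {c, d}, {d, y}}" for x y a b c d
  proof -
    let ?P = "{{x, a}, {a, b}, {b, c}, {c, d}, {d, y}}"
    have "{x, y} \<notin> ?P" using that(2) by (auto simp: doubleton_eq_iff)
    then have P: "hex_edges h - {e} = ?P" unfolding that(1,4) by (rule Diff_insert_absorb)
    show ?thesis
    proof (rule result)
      show "e = {x, y}" by (rule that(1))
      show "x \<noteq> y" "distinct [a, b, c, d]" "length [a, b, c, d] = 4" "set [a, b, c, d] \<inter> {x, y} = {}"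
        using that(2) by auto
      show "hex_verts h = {x, y} \<union> set [a, b, c, d]" unfolding that(3) by auto
      show "path_edges (x # [a, b, c, d] @ [y]) = hex_edges h - {e}" unfolding P by simp
      show "card (hex_edges h - {e}) = 5"
        unfolding P using that(2) by (auto simp: doubleton_eq_iff card_insert_if)
    qed
  qed
  from assms have "e \<in> {{A, B}, {B, C}, {C, D}, {D, E}, {E, F}, {F, A}}" unfolding edges .
  then show ?thesis
  proof (elim insertE emptyE)
    assume ends: "e = {A, B}"
    show ?thesis
      by (rule *[of A B F E D C, OF ends]) ((simp only: verts edges insert_commute; fail) | (insert dist, auto)[1])+
  next
    assume ends: "e = {B, C}"
    show ?thesis
      by (rule *[of B C A F E D, OF ends]) ((simp only: verts edges insert_commute; fail) | (insert dist, auto)[1])+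
  next
    assume ends: "e = {C, D}"
    show ?thesis
      by (rule *[of C D B A F E, OF ends]) ((simp only: verts edges insert_commute; fail) | (insert dist, auto)[1])+
  next
    assume ends: "e = {D, E}"
    show ?thesis
      by (rule *[of D E C B A F, OF ends]) ((simp only: verts edges insert_commute; fail) | (insert dist, auto)[1])+
  next
    assume ends: "e = {E, F}"
    show ?thesis
      by (rule *[of E F D C B A, OF ends]) ((simp only: verts edges insert_commute; fail) | (insert dist, auto)[1])+
  next
    assume ends: "e = {F, A}"
    show ?thesis
      by (rule *[of F A E D C B, OF ends]) ((simp only: verts edges insert_commute; fail) | (insert dist, auto)[1])+
  qed
qed

text \<open>The six possible relative positions of neighbouring cells are inspected in coordinates relative to
the centre of \<open>h\<close>: in each position at most two corners are common, and \<open>e\<close> provides two.\<close>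

lemma hex_verts_Int_adjacent:
  assumes "h \<noteq> g" "e \<in> hex_edges h" "e \<in> hex_edges g"
  shows "hex_verts h \<inter> hex_verts g = e"
proof -
  obtain q r q' r' where h: "h = (q, r)" "g = (q', r')" by fastforce
  have adj: "adjacent (q, r) (q', r')" using assms by (auto simp: adjacent_def h)
  define X Y where "X p = fst p - (q - r)" and "Y p = snd p - (q + 2*r)" for p :: point
  have two: "\<exists>a b. hex_verts h \<inter> hex_verts g \<subseteq> {a, b}"
    if pt: "\<And>p. p \<in> hex_verts h \<Longrightarrow> p \<in> hex_verts g \<Longrightarrow> X p = i \<and> Y p = j \<or> X p = k \<and> Y p = l" for i j k l
  proof -
    have "p \<in> {(q - r + i, q + 2*r + j), (q - r + k, q + 2*r + l)}"
      if "p \<in> hex_verts h" "p \<in> hex_verts g" for p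
      using pt[OF that] by (cases p) (auto simp: X_def Y_def)
    then show ?thesis by blast
  qed
  have off: "X p = 1 \<and> Y p = 0 \<or> X p = 0 \<and> Y p = 1 \<or> X p = -1 \<and> Y p = 1 \<or>
      X p = -1 \<and> Y p = 0 \<or> X p = 0 \<and> Y p = -1 \<or> X p = 1 \<and> Y p = -1"
    if "p \<in> hex_verts h" for p
    using hex_verts_offset[of p q r] that unfolding h X_def Y_def by blast
  \<comment> \<open>The offset between the two centres.\<close>
  define dx dy where "dx = (q' - r') - (q - r)" and "dy = (q' + 2*r') - (q + 2*r)"
  have off': "X p - dx = 1 \<and> Y p - dy = 0 \<or> X p - dx = 0 \<and> Y p - dy = 1 \<or> X p - dx = -1 \<and> Y p - dy = 1 \<or>
      X p - dx = -1 \<and> Y p - dy = 0 \<or> X p - dx = 0 \<and> Y p - dy = -1 \<or> X p - dx = 1 \<and> Y p - dy = -1"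
    if "p \<in> hex_verts g" for p
  proof -
    have "X p - dx = fst p - (q' - r')" "Y p - dy = snd p - (q' + 2*r')"
      by (simp_all add: X_def Y_def dx_def dy_def)
    then show ?thesis using hex_verts_offset[of p q' r'] that unfolding h by (simp only:)
  qed
  have "dx = 1 \<and> dy = 1 \<or> dx = -1 \<and> dy = 2 \<or> dx = -2 \<and> dy = 1 \<or>
      dx = -1 \<and> dy = -1 \<or> dx = 1 \<and> dy = -2 \<or> dx = 2 \<and> dy = -1"
    using adj unfolding adjacent_iff dx_def dy_def by (elim disjE conjE) simp_all
  then have "\<exists>a b. hex_verts h \<inter> hex_verts g \<subseteq> {a, b}"
  proof (elim disjE conjE)
    assume d: "dx = 1" "dy = 1"
    show ?thesis
      by (rule two[of "1" "0" "0" "1"], drule off, drule off', unfold d) (elim disjE conjE; linarith)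
  next
    assume d: "dx = -1" "dy = 2"
    show ?thesis
      by (rule two[of "0" "1" "-1" "1"], drule off, drule off', unfold d) (elim disjE conjE; linarith)
  next
    assume d: "dx = -2" "dy = 1"
    show ?thesis
      by (rule two[of "-1" "1" "-1" "0"], drule off, drule off', unfold d) (elim disjE conjE; linarith)
  next
    assume d: "dx = -1" "dy = -1"
    show ?thesis
      by (rule two[of "-1" "0" "0" "-1"], drule off, drule off', unfold d) (elim disjE conjE; linarith)
  next
    assume d: "dx = 1" "dy = -2"
    show ?thesis
      by (rule two[of "0" "-1" "1" "-1"], drule off, drule off', unfold d) (elim disjE conjE; linarith)
  next
    assume d: "dx = 2" "dy = -1"
    show ?thesis
      by (rule two[of "1" "-1" "1" "0"], drule off, drule off', unfold d) (elim disjE conjE; linarith)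
  qed
  then obtain a b where ab: "hex_verts h \<inter> hex_verts g \<subseteq> {a, b}" by blast
  obtain c d where cd: "e = {c, d}" "c \<noteq> d" using hex_edge_ends[OF assms(2)] by blast
  have I: "e \<subseteq> hex_verts h \<inter> hex_verts g" using assms(2,3) hex_edge_subset by blast
  have "c \<in> {a, b}" "d \<in> {a, b}" using I ab cd(1) by auto
  then have "{a, b} = e" using cd by auto
  then show ?thesis using I ab by (intro equalityI) simp_all
qed

lemma shared_edge_unique:
  assumes "h \<noteq> g" "e \<in> hex_edges h" "e \<in> hex_edges g" "f \<in> hex_edges h" "f \<in> hex_edges g"
  shows "f = e"
  using hex_verts_Int_adjacent[OF assms(1-3)] hex_verts_Int_adjacent[OF assms(1,4,5)] by simp

text \<open>Seen from \<open>K\<close>, the new hexagon is an ear of five edges between the ends of \<open>e\<close>. The trees of \<open>K\<close>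
with \<open>e\<close> contracted are those of \<open>K\<close> that contain \<open>e\<close>, so their number is the difference between the
counts with \<open>e\<close> and without \<open>e\<close>. This turns \<open>5 \<tau>(K)\<close> into \<open>6 \<tau>(K) - \<tau>(K - e)\<close>, or, if \<open>e\<close> itself is to
be deleted, into \<open>4 \<tau>(K - e) + \<tau>(K)\<close>. The set \<open>D\<close> of further deleted edges is carried along because
later steps need the counts for graphs with several edges removed.\<close>

lemma attach_hexagon:
  assumes "finite K" "g \<in> K" "h \<notin> K" "\<And>k. k \<in> K \<Longrightarrow> adjacent h k \<Longrightarrow> k = g"
    and e: "e \<in> hex_edges h" "e \<in> hex_edges g"
  shows "D \<inter> hex_edges h = {} \<Longrightarrow>
      trees_without (insert h K) D = 6 * trees_without K D - trees_without K (insert e D)"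
    and "D \<inter> hex_edges h = {} \<Longrightarrow>
      trees_without (insert h K) (insert e D) = 4 * trees_without K (insert e D) + trees_without K D"
    and "D \<inter> hex_edges h \<subseteq> {e} \<Longrightarrow> f \<in> hex_edges h \<Longrightarrow> f \<noteq> e \<Longrightarrow>
      trees_without (insert h K) (insert f D) = trees_without K D"
    and "f \<in> hex_edges h \<Longrightarrow> f' \<in> hex_edges h \<Longrightarrow> f \<noteq> e \<Longrightarrow> f' \<noteq> e \<Longrightarrow> f \<noteq> f' \<Longrightarrow> f \<in> D \<Longrightarrow> f' \<in> D \<Longrightarrow>
      trees_without (insert h K) D = 0"
proof -
  let ?V = "bz_verts K" and ?E = "bz_edges K" and ?N = "\<lambda>E C. int (tree_extensions (bz_verts K) E C)"
  obtain x y ps where ear: "e = {x, y}" "x \<noteq> y" "distinct ps" "length ps = 4" "set ps \<inter> {x, y} = {}"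
    "hex_verts h = {x, y} \<union> set ps" "path_edges (x # ps @ [y]) = hex_edges h - {e}"
    "card (hex_edges h - {e}) = 5"
    by (rule hexagon_as_ear[OF e(1)])
  let ?P = "hex_edges h - {e}"
  have hg: "h \<noteq> g" using assms(2,3) by blast
  have "p \<in> e" if p: "p \<in> hex_verts h" "p \<in> ?V" for p
  proof -
    obtain k where k: "k \<in> K" "p \<in> hex_verts k" using p(2) by (auto simp: bz_verts_def)
    then have "k = g" using assms(3,4) share_vertex_imp_adjacent that(1) by metis
    then show ?thesis using hex_verts_Int_adjacent[OF hg e] that(1) k(2) by blast
  qed
  moreover have eE: "e \<in> ?E" using e(2) assms(2) by (auto simp: bz_edges_def)
  moreover have "x \<in> ?V" "y \<in> ?V" using bz_edge_subset[OF eE] ear(1) by auto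
  ultimately have V: "x \<in> ?V" "y \<in> ?V" "set ps \<inter> ?V = {}" "e \<in> ?E"
    using ear(1,5,6) by auto
  have P: "f \<notin> ?E" if "f \<in> ?P" for f
  proof
    assume "f \<in> ?E"
    then obtain k where k: "k \<in> K" "f \<in> hex_edges k" by (auto simp: bz_edges_def)
    then have "adjacent h k" using that assms(3) by (auto simp: adjacent_def)
    then have "k = g" using assms(4) k(1) by blast
    then show False using shared_edge_unique[OF hg e] k(2) that by blast
  qed
  have verts: "bz_verts (insert h K) = ?V \<union> set ps"
    using V ear(6) by (auto simp: bz_verts_def)
  have edges: "bz_edges (insert h K) - D = (?E - D) \<union> (?P - D)" for D
    using V(4) by (auto simp: bz_edges_def)
  have fin: "finite ?V" "finite ?E" using assms(1) by (simp_all add: finite_bz_verts finite_bz_edges)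
  have main: "trees_without (insert h K) D = (if ?P - D = ?P then 5 * ?N (?E - D) {} + ?N (?E - D) {e}
      else if card (?P - (?P - D)) = 1 then ?N (?E - D) {} else 0)" for D
  proof -
    have "tree_extensions (?V \<union> set ps) ((?E - D) \<union> (?P - D)) {} =
      (if ?P - D = path_edges (x # ps @ [y])
       then (length ps + 1) * tree_extensions ?V (?E - D) {} + tree_extensions ?V (?E - D) {{x, y}}
       else if card (path_edges (x # ps @ [y]) - (?P - D)) = 1 then tree_extensions ?V (?E - D) {} else 0)"
      using fin V ear bz_edge_subset by (intro tree_extensions_ear) auto
    then show ?thesis
      unfolding trees_without_def verts edges ear(7) ear(4) ear(1)[symmetric] by simp
  qed
  have two: "\<exists>a b. f = {a, b}" if "f \<in> ?E" for f using bz_edge_ends[OF that] by blast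
  have contract: "?N (?E - D) {e} = trees_without K (D - {e}) - trees_without K (insert e D)" for D
  proof -
    let ?E' = "?E - insert e D"
    have 1: "?N (insert e ?E') {} = ?N ?E' {} + ?N ?E' {e}"
      using fin(2) by (simp add: deletion_contraction)
    have 2: "?N (insert e ?E') {e} = ?N ?E' {e}"
      unfolding ear(1) using fin two V(4) ear(1)
      by (subst tree_extensions_parallel) (auto simp: constant_along_insert)
    have 3: "?E - (D - {e}) = insert e ?E'" using V(4) by auto
    have "?N (?E - D) {e} = ?N ?E' {e}"
    proof (cases "e \<in> D")
      case True
      then show ?thesis by (simp add: insert_absorb)
    next
      case False
      then have "?E - D = insert e ?E'" using V(4) by auto
      then show ?thesis using 2 by simp
    qed
    then show ?thesis using 1 unfolding trees_without_def 3 by simp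
  qed
  show "trees_without (insert h K) D = 6 * trees_without K D - trees_without K (insert e D)"
    if "D \<inter> hex_edges h = {}"
  proof -
    have "?P - D = ?P" "D - {e} = D" using that e(1) by auto
    then show ?thesis using main[of D] contract[of D] by (simp add: trees_without_def)
  qed
  show "trees_without (insert h K) (insert e D) = 4 * trees_without K (insert e D) + trees_without K D"
    if "D \<inter> hex_edges h = {}"
  proof -
    have "?P - insert e D = ?P" "insert e D - {e} = D" using that e(1) by auto
    then show ?thesis using main[of "insert e D"] contract[of "insert e D"] by (simp add: trees_without_def)
  qed
  show "trees_without (insert h K) (insert f D) = trees_without K D"
    if "D \<inter> hex_edges h \<subseteq> {e}" "f \<in> hex_edges h" "f \<noteq> e"
  proof -
    have f: "?P - (?P - insert f D) = {f}" using that by auto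
    then have "?P - insert f D \<noteq> ?P" by auto
    moreover have "?E - insert f D = ?E - D" using P[of f] that by auto
    ultimately show ?thesis using main[of "insert f D"] unfolding f trees_without_def by simp
  qed
  show "trees_without (insert h K) D = 0"
    if "f \<in> hex_edges h" "f' \<in> hex_edges h" "f \<noteq> e" "f' \<noteq> e" "f \<noteq> f'" "f \<in> D" "f' \<in> D"
  proof -
    have "{f, f'} \<subseteq> ?P - (?P - D)" using that by auto
    then have "card {f, f'} \<le> card (?P - (?P - D))"
      by (rule card_mono[rotated]) (simp add: finite_hex_edges)
    then have "card (?P - (?P - D)) \<noteq> 1" using that(5) by simp
    moreover have "?P - D \<noteq> ?P" using that by auto
    ultimately show ?thesis using main[of D] by simp
  qed
qed

text \<open>The state of a growing chain with last hexagon \<open>h\<close>: \<open>x\<close> is the number of spanning trees and \<open>y\<close> the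
number after the deletion of an edge that belongs to \<open>h\<close> only. That number is the same for all such
edges, since what remains of the ear is pendant, and the deletion of two of them leaves no spanning
tree.\<close>

definition end_hexagon :: "cell set \<Rightarrow> cell \<Rightarrow> int \<Rightarrow> int \<Rightarrow> bool" where
  "end_hexagon K h x y \<longleftrightarrow> finite K \<and> h \<in> K \<and> trees_without K {} = x \<and>
     (\<forall>f \<in> hex_edges h - bz_edges (K - {h}). trees_without K {f} = y) \<and>
     (\<forall>f \<in> hex_edges h - bz_edges (K - {h}). \<forall>f' \<in> hex_edges h - bz_edges (K - {h}).
        \<forall>D. f \<noteq> f' \<longrightarrow> f \<in> D \<longrightarrow> f' \<in> D \<longrightarrow> trees_without K D = 0)"

lemma end_hexagon_attach:
  assumes "finite K" "g \<in> K" "h \<notin> K" "\<And>k. k \<in> K \<Longrightarrow> adjacent h k \<Longrightarrow> k = g"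
    and e: "e \<in> hex_edges h" "e \<in> hex_edges g"
  shows "end_hexagon (insert h K) h (6 * trees_without K {} - trees_without K {e}) (trees_without K {})"
proof -
  have "insert h K - {h} = K" using assms(3) by blast
  moreover have "e \<in> bz_edges K" using assms(2) e(2) by (auto simp: bz_edges_def)
  ultimately show ?thesis
    unfolding end_hexagon_def
    using attach_hexagon(1)[OF assms, of "{}"] attach_hexagon(3)[OF assms, of "{}"]
      attach_hexagon(4)[OF assms] assms(1)
    by (intro conjI ballI allI impI) (simp_all, blast+)
qed

text \<open>A hexagon is an ear attached to any one of its edges; that edge has to be one that is not deleted.\<close>

lemma end_hexagon_single: "end_hexagon {h} h 6 1"
proof -
  have verts: "bz_verts {h} = hex_verts h" and edges: "bz_edges {h} = hex_edges h"
    by (simp_all add: bz_verts_def bz_edges_def)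
  have main: "trees_without {h} D = (if hex_edges h - {e} - D = hex_edges h - {e} then 6
      else if card (hex_edges h - {e} - (hex_edges h - {e} - D)) = 1 then 1 else 0)"
    if e: "e \<in> hex_edges h" "e \<notin> D" for e D
  proof -
    let ?P = "hex_edges h - {e}"
    obtain x y ps where ear: "e = {x, y}" "x \<noteq> y" "distinct ps" "length ps = 4" "set ps \<inter> {x, y} = {}"
      "hex_verts h = {x, y} \<union> set ps" "path_edges (x # ps @ [y]) = ?P"
      by (rule hexagon_as_ear[OF e(1)])
    have Z: "tree_extensions {x, y} {} {} = 0"
      using ear(2) by (intro tree_extensions_isolated[of x _ y]) auto
    have "{F :: point set set. F = {} \<and> card F = 0} = {{}}" by auto
    then have "tree_extensions {y} {} {} = 1"
      by (simp add: tree_extensions_def graph_connected_def)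
    then have C: "tree_extensions {x, y} {} {{x, y}} = 1"
      using tree_extensions_absorb[of x "{y}" y "{}" "{}"] ear(2) by simp
    have 1: "tree_extensions {x, y} {{x, y}} {} = 1"
      using deletion_contraction[of "{}" "{}" "{x, y}" "{x, y}"] Z C by simp
    have "\<exists>a b. d = {a, b}" if "d \<in> {} \<union> {{x, y}}" for d using that by blast
    then have 2: "tree_extensions {x, y} {{x, y}} {{x, y}} = 1"
      using C by (subst tree_extensions_parallel) (simp_all add: constant_along_insert)
    have "hex_edges h - D = {{x, y}} \<union> (?P - D)" using e ear(1) by auto
    moreover have "tree_extensions ({x, y} \<union> set ps) ({{x, y}} \<union> (?P - D)) {} =
      (if ?P - D = path_edges (x # ps @ [y])
       then (length ps + 1) * tree_extensions {x, y} {{x, y}} {} + tree_extensions {x, y} {{x, y}} {{x, y}}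
       else if card (path_edges (x # ps @ [y]) - (?P - D)) = 1 then tree_extensions {x, y} {{x, y}} {} else 0)"
      using ear by (intro tree_extensions_ear) auto
    ultimately show ?thesis
      unfolding trees_without_def verts edges ear(6) ear(7) 1 2 ear(4) by simp
  qed
  have "{corners h ! 0, corners h ! (Suc 0 mod 6)} \<in> hex_edges h"
    unfolding hex_edges_def by (rule CollectI, rule exI[of _ 0]) simp
  then obtain e0 where e0: "e0 \<in> hex_edges h" by blast
  have other: "\<exists>e \<in> hex_edges h. e \<noteq> f" if "f \<in> hex_edges h" for f
  proof -
    have "card (hex_edges h - {f}) = 5" using that by (rule hexagon_as_ear)
    then have "hex_edges h - {f} \<noteq> {}" by (metis card.empty zero_neq_numeral)
    then show ?thesis by blast
  qed
  have "trees_without {h} {f} = 1" if f: "f \<in> hex_edges h" for f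
  proof -
    obtain e where e: "e \<in> hex_edges h" "e \<noteq> f" using other f by blast
    have 1: "hex_edges h - {e} - (hex_edges h - {e} - {f}) = {f}" using e f by blast
    then have "hex_edges h - {e} - {f} \<noteq> hex_edges h - {e}" by blast
    then show ?thesis using main[of e "{f}"] e unfolding 1 by simp
  qed
  moreover have "trees_without {h} D = 0"
    if f: "f \<in> hex_edges h" "f' \<in> hex_edges h" "f \<noteq> f'" "f \<in> D" "f' \<in> D" for f f' D
  proof (cases "hex_edges h \<subseteq> D")
    case True
    then have D: "hex_edges h - D = {}" by blast
    obtain x y ps where xy: "x \<noteq> y" "hex_verts h = {x, y} \<union> set ps"
      by (rule hexagon_as_ear[OF e0])
    have "tree_extensions (hex_verts h) {} {} = 0"
      using xy by (intro tree_extensions_isolated[of x _ y]) auto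
    then show ?thesis unfolding trees_without_def verts edges D by simp
  next
    case False
    then obtain e where e: "e \<in> hex_edges h" "e \<notin> D" by blast
    have "{f, f'} \<subseteq> hex_edges h - {e} - (hex_edges h - {e} - D)" using f e by blast
    then have "card {f, f'} \<le> card (hex_edges h - {e} - (hex_edges h - {e} - D))"
      by (rule card_mono[rotated]) (simp add: finite_hex_edges)
    then have "card (hex_edges h - {e} - (hex_edges h - {e} - D)) \<noteq> 1" using f(3) by simp
    moreover have "hex_edges h - {e} - D \<noteq> hex_edges h - {e}" using f e by blast
    ultimately show ?thesis using main[OF e] by simp
  qed
  moreover have "trees_without {h} {} = 6" using main[OF e0, of "{}"] by simp
  ultimately show ?thesis unfolding end_hexagon_def by blast
qed

lemma end_hexagonD:
  assumes "end_hexagon K h x y"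
  shows "finite K" "h \<in> K" "trees_without K {} = x"
    and "f \<in> hex_edges h \<Longrightarrow> f \<notin> bz_edges (K - {h}) \<Longrightarrow> trees_without K {f} = y"
    and "f \<in> hex_edges h \<Longrightarrow> f \<notin> bz_edges (K - {h}) \<Longrightarrow> f' \<in> hex_edges h \<Longrightarrow>
      f' \<notin> bz_edges (K - {h}) \<Longrightarrow> f \<noteq> f' \<Longrightarrow> f \<in> D \<Longrightarrow> f' \<in> D \<Longrightarrow> trees_without K D = 0"
  using assms unfolding end_hexagon_def by blast+

lemma adjacent_obtain_edge:
  assumes "adjacent h g"
  obtains e where "h \<noteq> g" "e \<in> hex_edges h" "e \<in> hex_edges g"
  using assms unfolding adjacent_def by blast

lemma edge_notin_bz_edges:
  assumes "e \<in> hex_edges h" "h \<notin> K" "\<And>k. k \<in> K \<Longrightarrow> \<not> adjacent h k"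
  shows "e \<notin> bz_edges K"
  using assms unfolding bz_edges_def adjacent_def by blast

text \<open>The hexagon \<open>h\<close> fills the corner at \<open>z\<close> between the adjacent hexagons \<open>u\<close> and \<open>w\<close>. Here \<open>zx\<close> is its common
edge with \<open>u\<close>, \<open>zy\<close> that with \<open>w\<close>, and \<open>zv\<close> the common edge of \<open>u\<close> and \<open>w\<close>. The remaining four edges of
\<open>h\<close> form an ear from \<open>x\<close> to \<open>y\<close>, which gives \<open>4 \<tau>(K)\<close> and the trees of \<open>K\<close> with \<open>xy\<close> contracted. Since three
hexagons meet at \<open>z\<close>, the three edges above are all that \<open>z\<close> has, and the contraction of \<open>xy\<close> can be
expressed by deletions at \<open>z\<close>. If \<open>zv\<close> is deleted, \<open>zx\<close> and \<open>zy\<close> form a path and the expression is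
simpler.\<close>

lemma attach_in_corner:
  assumes K: "finite K" "u \<in> K" "w \<in> K" "h \<notin> K"
      "\<And>k. k \<in> K \<Longrightarrow> adjacent h k \<Longrightarrow> k = u \<or> k = w"
    and dist: "distinct [x, y, v, z]" "distinct ps" "set ps \<inter> {x, y, z} = {}" "length ps = 3"
    and verts: "hex_verts h = {x, y, z} \<union> set ps" "hex_verts h \<inter> (hex_verts u \<union> hex_verts w) = {x, y, z}"
    and edges: "hex_edges h = {{z, x}, {z, y}} \<union> path_edges (x # ps @ [y])"
    and at_z: "{f \<in> hex_edges u \<union> hex_edges w. z \<in> f} = {{z, x}, {z, y}, {z, v}}"
    and D: "D \<inter> hex_edges h = {}"
  shows "{z, v} \<notin> D \<Longrightarrow> trees_without (insert h K) D = 6 * trees_without K D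
      - 2 * trees_without K (insert {z, x} D) - 2 * trees_without K (insert {z, y} D)
      + trees_without K (insert {z, v} D)"
    and "{z, v} \<in> D \<Longrightarrow> trees_without (insert h K) D =
      6 * trees_without K D - 4 * trees_without K (insert {z, x} D)"
proof -
  define V where "V = bz_verts K - {z}"
  define E where "E = {f \<in> bz_edges K - D. z \<notin> f}"
  let ?P = "path_edges (x # ps @ [y])"
  have near: "p \<in> {x, y, z}" if p: "p \<in> hex_verts h" "p \<in> bz_verts K" for p
  proof -
    obtain k where k: "k \<in> K" "p \<in> hex_verts k" using p(2) by (auto simp: bz_verts_def)
    moreover have "h \<noteq> k" using K(4) k(1) by blast
    ultimately have "k = u \<or> k = w" using K(5) share_vertex_imp_adjacent p(1) by metis
    then show ?thesis using verts(2) p(1) k(2) by blast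
  qed
  have ends: "{z, x} \<in> bz_edges K" "{z, y} \<in> bz_edges K" "{z, v} \<in> bz_edges K"
  proof -
    have "{{z, x}, {z, y}, {z, v}} \<subseteq> hex_edges u \<union> hex_edges w" using at_z by blast
    then show "{z, x} \<in> bz_edges K" "{z, y} \<in> bz_edges K" "{z, v} \<in> bz_edges K"
      using K(2,3) unfolding bz_edges_def by blast+
  qed
  then have in_V: "x \<in> V" "y \<in> V" "v \<in> V" and z: "z \<in> bz_verts K"
    using bz_edge_subset dist(1) unfolding V_def by auto
  have star: "{f \<in> bz_edges K. z \<in> f} = {{z, x}, {z, y}, {z, v}}"
  proof -
    have zh: "z \<in> hex_verts h" using verts(1) by blast
    have "f \<in> hex_edges u \<union> hex_edges w" if f: "f \<in> bz_edges K" "z \<in> f" for f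
    proof -
      obtain k where k: "k \<in> K" "f \<in> hex_edges k" using f(1) by (auto simp: bz_edges_def)
      then have "z \<in> hex_verts k" using f(2) hex_edge_subset by blast
      moreover have "h \<noteq> k" using K(4) k(1) by blast
      ultimately have "k = u \<or> k = w" using K(5) share_vertex_imp_adjacent zh k(1) by metis
      then show ?thesis using k(2) by blast
    qed
    then show ?thesis using at_z ends by blast
  qed
  have split: "bz_edges K - D' = ({{z, x}, {z, y}, {z, v}} - D') \<union> E"
    if "D' \<subseteq> D \<union> {{z, x}, {z, y}, {z, v}}" "D \<subseteq> D'" for D'
    using star that unfolding E_def by blast
  have V: "insert z V = bz_verts K" using z unfolding V_def by blast
  have fresh: "set ps \<inter> bz_verts K = {}" using near verts(1) dist(3) by blast
  have verts': "bz_verts (insert h K) = bz_verts K \<union> set ps"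
  proof -
    have "bz_verts (insert h K) = hex_verts h \<union> bz_verts K" by (simp add: bz_verts_def)
    moreover have "{x, y, z} \<subseteq> bz_verts K" using V in_V by auto
    ultimately show ?thesis unfolding verts(1) by auto
  qed
  have edges': "bz_edges (insert h K) - D = (bz_edges K - D) \<union> ?P"
  proof -
    have "bz_edges (insert h K) = hex_edges h \<union> bz_edges K" by (simp add: bz_edges_def)
    moreover have "hex_edges h - D = hex_edges h" using D by auto
    moreover have "hex_edges h \<union> (bz_edges K - D) = (bz_edges K - D) \<union> ?P"
      using ends D unfolding edges by auto
    ultimately show ?thesis by (simp add: Un_Diff)
  qed
  have fin: "finite V" "finite E" "finite (bz_verts K)" "finite (bz_edges K)"
    using K(1) unfolding V_def E_def by (simp_all add: finite_bz_verts finite_bz_edges)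
  have xy: "x \<in> bz_verts K" "y \<in> bz_verts K" "x \<noteq> y" using in_V dist(1) by (auto simp: V_def)
  have E_sub: "e \<subseteq> bz_verts K" if "e \<in> bz_edges K - D" for e using that bz_edge_subset by blast
  have "ps \<noteq> []" using dist(4) by auto
  then have "tree_extensions (bz_verts K \<union> set ps) ((bz_edges K - D) \<union> ?P) {} =
      (length ps + 1) * tree_extensions (bz_verts K) (bz_edges K - D) {} +
      tree_extensions (bz_verts K) (bz_edges K - D) {{x, y}}"
    using tree_extensions_ear[where E = "bz_edges K - D" and Q = ?P,
        OF fin(3) _ xy dist(2) fresh E_sub] fin(4) by simp
  then have main: "trees_without (insert h K) D =
      4 * trees_without K D + int (tree_extensions (bz_verts K) (bz_edges K - D) {{x, y}})"
    unfolding trees_without_def verts' edges' dist(4) by simp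
  have two: "\<exists>a b. e = {a, b}" if "e \<in> E" for e using that bz_edge_ends unfolding E_def by blast
  have ne: "x \<noteq> y" "x \<noteq> v" "y \<noteq> v" "z \<noteq> x" "z \<noteq> y" "z \<noteq> v" using dist(1) by auto
  have zV: "z \<notin> V" "\<And>e. e \<in> E \<Longrightarrow> z \<notin> e" unfolding V_def E_def by auto
  note corner = tree_extensions_corner[OF zV fin(1,2) in_V ne(1-3) two]
  have D': "{z, x} \<notin> D" "{z, y} \<notin> D" using D edges by auto
  show "trees_without (insert h K) D = 6 * trees_without K D
      - 2 * trees_without K (insert {z, x} D) - 2 * trees_without K (insert {z, y} D)
      + trees_without K (insert {z, v} D)" if v: "{z, v} \<notin> D"
  proof -
    have "bz_edges K - D = {{z, x}, {z, y}, {z, v}} \<union> E"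
      "bz_edges K - insert {z, x} D = {{z, y}, {z, v}} \<union> E"
      "bz_edges K - insert {z, y} D = {{z, x}, {z, v}} \<union> E"
      "bz_edges K - insert {z, v} D = {{z, x}, {z, y}} \<union> E"
      using D' v ne by (subst split; auto simp: doubleton_eq_iff)+
    then show ?thesis using main corner(1) unfolding trees_without_def V by simp
  qed
  show "trees_without (insert h K) D = 6 * trees_without K D - 4 * trees_without K (insert {z, x} D)"
    if v: "{z, v} \<in> D"
  proof -
    have "bz_edges K - D = {{z, x}, {z, y}} \<union> E"
      "bz_edges K - insert {z, x} D = {{z, y}} \<union> E"
      using D' v ne by (subst split; auto simp: doubleton_eq_iff)+
    then show ?thesis using main corner(2) unfolding trees_without_def V by simp
  qed
qed

section \<open>Iterating a unit of a chain\<close>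

text \<open>The orbit of \<open>(1, 0)\<close> under the matrix with rows \<open>(p, -q)\<close> and \<open>(r, -s)\<close>. The pair stands for the
spanning trees of a graph and of the same graph without the edge at which the next unit is attached;
a single edge has the pair \<open>(1, 0)\<close>.\<close>

primrec iterate_unit :: "int \<Rightarrow> int \<Rightarrow> int \<Rightarrow> int \<Rightarrow> nat \<Rightarrow> int \<times> int" where
  "iterate_unit p q r s 0 = (1, 0)"
| "iterate_unit p q r s (Suc n) =
     (let (A, B) = iterate_unit p q r s n in (p * A - q * B, r * A - s * B))"

text \<open>With eigenvalues \<open>\<kappa>\<close> and \<open>\<mu>\<close>, the second entry vanishes at \<open>0\<close> and therefore is
\<open>\<gamma> (\<kappa>\<^sup>n - \<mu>\<^sup>n)\<close>. The hypotheses say that \<open>(\<alpha>, \<gamma>)\<close> and \<open>(\<beta>, -\<gamma>)\<close> are eigenvectors.\<close>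

lemma iterate_unit_closed_form:
  fixes \<alpha> \<beta> \<gamma> \<kappa> \<mu> :: real
  assumes "\<alpha> + \<beta> = 1"
    and "\<alpha> * \<kappa> = p * \<alpha> - q * \<gamma>" "\<beta> * \<mu> = p * \<beta> + q * \<gamma>"
    and "\<gamma> * \<kappa> = r * \<alpha> - s * \<gamma>" "\<gamma> * \<mu> = - r * \<beta> - s * \<gamma>"
  shows "real_of_int (fst (iterate_unit p q r s n)) = \<alpha> * \<kappa> ^ n + \<beta> * \<mu> ^ n"
proof -
  have "real_of_int (fst (iterate_unit p q r s n)) = \<alpha> * \<kappa> ^ n + \<beta> * \<mu> ^ n \<and>
      real_of_int (snd (iterate_unit p q r s n)) = \<gamma> * \<kappa> ^ n - \<gamma> * \<mu> ^ n"
  proof (induction n)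
    case 0
    then show ?case using assms(1) by simp
  next
    case (Suc n)
    have "\<alpha> * \<kappa> ^ Suc n + \<beta> * \<mu> ^ Suc n = (\<alpha> * \<kappa>) * \<kappa> ^ n + (\<beta> * \<mu>) * \<mu> ^ n" by simp
    also have "\<dots> = p * (\<alpha> * \<kappa> ^ n + \<beta> * \<mu> ^ n) - q * (\<gamma> * \<kappa> ^ n - \<gamma> * \<mu> ^ n)"
      unfolding assms(2,3) by (simp add: algebra_simps)
    finally have 1: "\<alpha> * \<kappa> ^ Suc n + \<beta> * \<mu> ^ Suc n = \<dots>" .
    have "\<gamma> * \<kappa> ^ Suc n - \<gamma> * \<mu> ^ Suc n = (\<gamma> * \<kappa>) * \<kappa> ^ n - (\<gamma> * \<mu>) * \<mu> ^ n" by simp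
    also have "\<dots> = r * (\<alpha> * \<kappa> ^ n + \<beta> * \<mu> ^ n) - s * (\<gamma> * \<kappa> ^ n - \<gamma> * \<mu> ^ n)"
      unfolding assms(4,5) by (simp add: algebra_simps)
    finally have 2: "\<gamma> * \<kappa> ^ Suc n - \<gamma> * \<mu> ^ Suc n = \<dots>" .
    show ?case using Suc unfolding 1 2 by (simp add: case_prod_beta Let_def)
  qed
  then show ?thesis by blast
qed

section \<open>Triphenylene chains\<close>

text \<open>The hexagons of a unit are added in the order \<open>c, b, w\<close>. Each has a single neighbour among those
present before, and the edges at which \<open>b\<close> and \<open>w\<close> are attached belong to \<open>c\<close> only. The counts are
\<open>6 x - y\<close> with \<open>c\<close>, then \<open>35 x - 6 y\<close> with \<open>b\<close>, and \<open>6 x\<close> if in addition the edge for \<open>w\<close> is deleted.\<close>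

lemma triphenylene_unit:
  assumes u: "end_hexagon K u x y"
    and c: "c \<notin> K" "adjacent c u" "\<And>k. k \<in> K \<Longrightarrow> adjacent c k \<Longrightarrow> k = u"
    and b: "b \<notin> K" "b \<noteq> c" "adjacent b c" "\<And>k. k \<in> K \<Longrightarrow> \<not> adjacent b k"
    and w: "w \<notin> K" "w \<noteq> c" "w \<noteq> b" "adjacent w c" "\<not> adjacent w b" "\<And>k. k \<in> K \<Longrightarrow> \<not> adjacent w k"
  shows "end_hexagon (insert w (insert b (insert c K))) w (204 * x - 36 * y) (35 * x - 6 * y)"
proof -
  let ?C = "insert c K"
  let ?B = "insert b ?C"
  note fin = end_hexagonD(1)[OF u] and uK = end_hexagonD(2)[OF u]
  obtain e where e: "e \<in> hex_edges c" "e \<in> hex_edges u" by (rule adjacent_obtain_edge[OF c(2)])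
  obtain f where f: "f \<in> hex_edges b" "f \<in> hex_edges c" by (rule adjacent_obtain_edge[OF b(3)])
  obtain g where g: "g \<in> hex_edges w" "g \<in> hex_edges c" by (rule adjacent_obtain_edge[OF w(4)])
  have e_rim: "e \<notin> bz_edges (K - {u})"
    using c(1,3) by (intro edge_notin_bz_edges[OF e(1)]) auto
  have "end_hexagon ?C c (6 * trees_without K {} - trees_without K {e}) (trees_without K {})"
    by (rule end_hexagon_attach[OF fin uK c(1) c(3) e])
  then have C: "end_hexagon ?C c (6 * x - y) x"
    using end_hexagonD(3)[OF u] end_hexagonD(4)[OF u e(2) e_rim] by simp
  have "?C - {c} = K" using c(1) by blast
  then have f_rim: "f \<notin> bz_edges (?C - {c})" and g_rim: "g \<notin> bz_edges (?C - {c})"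
    using edge_notin_bz_edges[OF f(1) b(1) b(4)] edge_notin_bz_edges[OF g(1) w(1) w(6)] by simp_all
  have gb: "g \<notin> hex_edges b" using g(1) w(3,5) by (auto simp: adjacent_def)
  then have fg: "f \<noteq> g" using f(1) by blast
  have b_nbr: "k = c" if "k \<in> ?C" "adjacent b k" for k using that b(4) by blast
  note attach_b = attach_hexagon(1)[OF _ _ _ b_nbr f, of ?C]
  have "trees_without ?B {} = 6 * trees_without ?C {} - trees_without ?C {f}"
    using fin b(1,2) by (intro attach_b) auto
  then have B: "trees_without ?B {} = 35 * x - 6 * y"
    using end_hexagonD(3)[OF C] end_hexagonD(4)[OF C f(2) f_rim] by simp
  have "trees_without ?B {g} = 6 * trees_without ?C {g} - trees_without ?C {f, g}"
    using fin b(1,2) gb by (intro attach_b) auto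
  then have Bg: "trees_without ?B {g} = 6 * x"
    using end_hexagonD(4)[OF C g(2) g_rim] end_hexagonD(5)[OF C f(2) f_rim g(2) g_rim fg] by simp
  have w_nbr: "k = c" if "k \<in> ?B" "adjacent w k" for k using that w(5,6) by blast
  have "end_hexagon (insert w ?B) w (6 * trees_without ?B {} - trees_without ?B {g}) (trees_without ?B {})"
    using fin w(1-3) by (intro end_hexagon_attach[OF _ _ _ w_nbr g]) auto
  then show ?thesis unfolding B Bg by simp
qed

text \<open>The adjacency list determines the order of construction, but not the shape of the chain: the first
hexagon \<open>u\<close> of a unit has only the last hexagon \<open>w\<close> of the previous unit as an earlier neighbour, and
the shared edge belongs to no third hexagon. So the state of the chain is known after each unit,
wherever the fusions take place.\<close>

lemma triphenylene_chain_count: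
  assumes n: "n \<ge> 1" and T: "triphenylene_chain n H"
  shows "trees_without H {} = fst (iterate_unit 1188 204 204 35 n)"
proof -
  define X where "X = iterate_unit 1188 204 204 35"
  obtain c u w b :: "nat \<Rightarrow> cell" where
    H: "H = c ` {1..n} \<union> u ` {1..n} \<union> w ` {1..n} \<union> b ` {1..n}"
    and P: "adjacent_pairs H =
          (\<Union>i\<in>{1..n}. {{c i, u i}, {c i, w i}, {c i, b i}}) \<union>
          (\<Union>i\<in>{1..<n}. {{w i, u (i + 1)}})"
    using T unfolding triphenylene_chain_def by (elim conjE exE) (rule that)
  have card: "card H = 4 * n" using T unfolding triphenylene_chain_def by (elim conjE)
  define L where "L ij = (if snd ij = 0 then c (fst ij) else if snd ij = 1 then u (fst ij)
      else if snd ij = 2 then w (fst ij) else b (fst ij))" for ij :: "nat \<times> nat"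
  have H_img: "H = L ` ({1..n} \<times> {0, 1, 2, 3})"
  proof
    show "H \<subseteq> L ` ({1..n} \<times> {0, 1, 2, 3})"
    proof
      fix h assume "h \<in> H"
      then consider i where "i \<in> {1..n}" "h = L (i, 0)" | i where "i \<in> {1..n}" "h = L (i, 1)"
        | i where "i \<in> {1..n}" "h = L (i, 2)" | i where "i \<in> {1..n}" "h = L (i, 3)"
        unfolding H L_def by auto
      then show "h \<in> L ` ({1..n} \<times> {0, 1, 2, 3})" by cases (auto intro!: imageI)
    qed
    show "L ` ({1..n} \<times> {0, 1, 2, 3}) \<subseteq> H" unfolding H L_def by auto
  qed
  \<comment> \<open>A count of \<open>4 * n\<close> hexagons forces the labels to be distinct.\<close>
  have inj: "inj_on L ({1..n} \<times> {0, 1, 2, 3})"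
    using card unfolding H_img by (intro eq_card_imp_inj_on) (simp_all add: card_cartesian_product)
  have L_eq: "L (i, j) = L (i', j') \<longleftrightarrow> i = i' \<and> j = j'"
    if "i \<in> {1..n}" "i' \<in> {1..n}" "j \<in> {0, 1, 2, 3}" "j' \<in> {0, 1, 2, 3}" for i i' j j'
    using inj_on_eq_iff[OF inj, of "(i, j)" "(i', j')"] that by simp
  have labels: "c i = L (i, 0)" "u i = L (i, 1)" "w i = L (i, 2)" "b i = L (i, 3)" for i
    by (simp_all add: L_def)
  define S where "S k = L ` ({1..k} \<times> {0, 1, 2, 3})" for k
  have S_sub: "S k \<subseteq> H" if "k \<le> n" for k using that unfolding S_def H_img by auto
  have mem: "L (i, j) \<in> H" if "i \<in> {1..n}" "j \<in> {0, 1, 2, 3}" for i j using that H_img by blast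
  have old: "L (i, j) \<notin> S k" if "i \<in> {1..n}" "k < i" "j \<in> {0, 1, 2, 3}" for i j k
  proof
    assume "L (i, j) \<in> S k"
    then obtain i' j' where "L (i, j) = L (i', j')" "i' \<in> {1..k}" "j' \<in> {0, 1, 2, 3}"
      unfolding S_def by blast
    moreover have "i' \<in> {1..n}" using calculation that by auto
    ultimately show False using L_eq[of i i' j j'] that by auto
  qed
  have pair: "{h, h'} \<in> adjacent_pairs H" if "adjacent h h'" "h \<in> H" "h' \<in> H" for h h'
    using that unfolding adjacent_pairs_def by blast
  have pairD: "adjacent h h'" if pair: "{h, h'} \<in> adjacent_pairs H" for h h'
  proof -
    obtain g g' where "{h, h'} = {g, g'}" "adjacent g g'"
      using pair unfolding adjacent_pairs_def by blast
    then show ?thesis by (auto simp: doubleton_eq_iff adjacent_sym)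
  qed
  have edge: "\<exists>i\<in>{1..n}. {h, h'} = {L (i, 0), L (i, 1)} \<or> {h, h'} = {L (i, 0), L (i, 2)} \<or>
      {h, h'} = {L (i, 0), L (i, 3)} \<or> Suc i \<in> {1..n} \<and> {h, h'} = {L (i, 2), L (Suc i, 1)}"
    if "adjacent h h'" "h \<in> H" "h' \<in> H" for h h'
  proof -
    have "{h, h'} \<in> (\<Union>i\<in>{1..n}. {{c i, u i}, {c i, w i}, {c i, b i}}) \<union>
        (\<Union>i\<in>{1..<n}. {{w i, u (i + 1)}})"
      using pair[OF that] unfolding P .
    then show ?thesis unfolding labels
    proof
      assume "{h, h'} \<in> (\<Union>i\<in>{1..<n}. {{L (i, 2), L (i + 1, 1)}})"
      then obtain i where "i \<in> {1..<n}" "{h, h'} = {L (i, 2), L (Suc i, 1)}" by auto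
      then show ?thesis by (intro bexI[of _ i]) auto
    qed blast
  qed
  note L_simps = doubleton_eq_iff L_eq
  have nbr_c: "h \<in> {L (m, 1), L (m, 2), L (m, 3)}"
    if "adjacent (L (m, 0)) h" "m \<in> {1..n}" "h \<in> H" for m h
    using edge[OF that(1) mem[OF that(2)] that(3)] that(2)
    by (simp, elim bexE disjE conjE) (auto simp: L_simps)
  have nbr_u: "h = L (m, 0) \<or> (\<exists>k. m = Suc k \<and> k \<in> {1..n} \<and> h = L (k, 2))"
    if "adjacent (L (m, 1)) h" "m \<in> {1..n}" "h \<in> H" for m h
    using edge[OF that(1) mem[OF that(2)] that(3)] that(2)
    by (simp, elim bexE disjE conjE) (auto simp: L_simps)
  have nbr_w: "h = L (m, 0) \<or> Suc m \<in> {1..n} \<and> h = L (Suc m, 1)"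
    if "adjacent (L (m, 2)) h" "m \<in> {1..n}" "h \<in> H" for m h
    using edge[OF that(1) mem[OF that(2)] that(3)] that(2)
    by (simp, elim bexE disjE conjE) (auto simp: L_simps)
  have nbr_b: "h = L (m, 0)"
    if "adjacent (L (m, 3)) h" "m \<in> {1..n}" "h \<in> H" for m h
    using edge[OF that(1) mem[OF that(2)] that(3)] that(2)
    by (simp, elim bexE disjE conjE) (auto simp: L_simps)
  have adj: "adjacent (L (m, 0)) (L (m, 1))" "adjacent (L (m, 2)) (L (m, 0))" "adjacent (L (m, 3)) (L (m, 0))"
    if "m \<in> {1..n}" for m
    unfolding labels[symmetric] using that
    by (intro pairD; unfold P; auto simp: insert_commute)+
  have adj_next: "adjacent (L (Suc m, 1)) (L (m, 2))" if "m \<in> {1..<n}" for m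
    unfolding labels[symmetric] using that by (intro pairD) (unfold P, auto simp: insert_commute)
  define Z where "Z k = insert (L (Suc k, 1)) (S k)" for k
  have unit: "end_hexagon (S (Suc k)) (L (Suc k, 2)) (fst (X (Suc k))) (snd (X (Suc k)))"
    if k: "k < n" and Z: "end_hexagon (Z k) (L (Suc k, 1)) (6 * fst (X k) - snd (X k)) (fst (X k))" for k
  proof -
    let ?m = "Suc k"
    have m: "?m \<in> {1..n}" using k by simp
    have Z_sub: "Z k \<subseteq> H" using S_sub[of k] k mem[OF m] unfolding Z_def by auto
    have new: "L (?m, 0) \<notin> Z k" "L (?m, 2) \<notin> Z k" "L (?m, 3) \<notin> Z k"
      using old[OF m, of k] L_eq[OF m m] unfolding Z_def by auto
    have next_new: "L (Suc ?m, 1) \<notin> Z k" if "Suc ?m \<in> {1..n}"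
      using old[OF that, of k] L_eq[OF that m] unfolding Z_def by auto
    have "end_hexagon (insert (L (?m, 2)) (insert (L (?m, 3)) (insert (L (?m, 0)) (Z k)))) (L (?m, 2))
      (204 * (6 * fst (X k) - snd (X k)) - 36 * fst (X k)) (35 * (6 * fst (X k) - snd (X k)) - 6 * fst (X k))"
    proof (rule triphenylene_unit[OF Z])
      show "h = L (?m, 1)" if "h \<in> Z k" "adjacent (L (?m, 0)) h" for h
        using nbr_c[OF that(2) m] that(1) Z_sub new by blast
      show "\<not> adjacent (L (?m, 3)) h" if "h \<in> Z k" for h
        using nbr_b[OF _ m, of h] that Z_sub new by blast
      show "\<not> adjacent (L (?m, 2)) h" if "h \<in> Z k" for h
        using nbr_w[OF _ m, of h] that Z_sub new next_new by blast
      show "\<not> adjacent (L (?m, 2)) (L (?m, 3))"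
      proof
        assume "adjacent (L (?m, 2)) (L (?m, 3))"
        then have "adjacent (L (?m, 3)) (L (?m, 2))" by (simp add: adjacent_sym)
        then have "L (?m, 2) = L (?m, 0)" using nbr_b[OF _ m mem[OF m]] by simp
        then show False by (simp add: L_eq[OF m m])
      qed
    qed (use new adj[OF m] L_eq[OF m m] in auto)
    moreover have "insert (L (?m, 2)) (insert (L (?m, 3)) (insert (L (?m, 0)) (Z k))) = S ?m"
    proof -
      have "{1..?m} = insert ?m {1..k}" by auto
      then show ?thesis unfolding Z_def S_def by auto
    qed
    ultimately show ?thesis unfolding X_def by (simp add: case_prod_beta Let_def)
  qed
  have "end_hexagon (Z k) (L (Suc k, 1)) (6 * fst (X k) - snd (X k)) (fst (X k))" if "k < n" for k
    using that
  proof (induction k)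
    case 0
    then show ?case using end_hexagon_single by (simp add: Z_def S_def X_def)
  next
    case (Suc k)
    let ?m = "Suc k"
    have m: "?m \<in> {1..n}" "Suc ?m \<in> {1..n}" using Suc.prems by auto
    have S: "end_hexagon (S ?m) (L (?m, 2)) (fst (X ?m)) (snd (X ?m))"
      using Suc by (intro unit) auto
    have mem_S: "L (?m, 2) \<in> S ?m" by (rule end_hexagonD(2)[OF S])
    have notin: "L (Suc ?m, j) \<notin> S ?m" if "j \<in> {0, 1, 2, 3}" for j
      using that by (intro old m) simp_all
    have only: "h = L (?m, 2)" if "h \<in> S ?m" "adjacent (L (Suc ?m, 1)) h" for h
      using nbr_u[OF that(2) m(2)] that(1) notin[of 0] S_sub[of ?m] m(1) by auto
    have "adjacent (L (Suc ?m, 1)) (L (?m, 2))" using Suc.prems by (intro adj_next) simp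
    then obtain e where e: "e \<in> hex_edges (L (Suc ?m, 1))" "e \<in> hex_edges (L (?m, 2))"
      by (rule adjacent_obtain_edge)
    have "e \<notin> bz_edges (S ?m - {L (?m, 2)})"
      using only notin[of 1] by (intro edge_notin_bz_edges[OF e(1)]) auto
    then have "trees_without (S ?m) {e} = snd (X ?m)" by (rule end_hexagonD(4)[OF S e(2)])
    moreover have "trees_without (S ?m) {} = fst (X ?m)" by (rule end_hexagonD(3)[OF S])
    ultimately show ?case
      using end_hexagon_attach[OF end_hexagonD(1)[OF S] mem_S notin only e] unfolding Z_def by simp
  qed
  moreover obtain k where "n = Suc k" using n by (cases n) auto
  ultimately have "end_hexagon (S n) (L (n, 2)) (fst (X n)) (snd (X n))" using unit by blast
  moreover have "S n = H" unfolding S_def H_img ..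
  ultimately show ?thesis using end_hexagonD(3) unfolding X_def by blast
qed

section \<open>Pyrene chains\<close>

text \<open>In the row of cells \<open>(q, 0)\<close> and \<open>(q + 1, 0)\<close>, the common edge has the ends \<open>(q, q + 1)\<close> and \<open>(q + 1, q)\<close>.
The upper cell fills the corner at the first and the lower cell the corner at the second.\<close>

lemma pyrene_corners:
  fixes q :: int
  shows "hex_verts (q, 1) = {(q - 1, q + 1), (q, q + 2), (q, q + 1)} \<union>
      set [(q - 2, q + 2), (q - 2, q + 3), (q - 1, q + 3)]" (is ?V1)
    and "hex_edges (q, 1) = {{(q, q + 1), (q - 1, q + 1)}, {(q, q + 1), (q, q + 2)}} \<union>
      path_edges ((q - 1, q + 1) # [(q - 2, q + 2), (q - 2, q + 3), (q - 1, q + 3)] @ [(q, q + 2)])" (is ?E1)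
    and "{f \<in> hex_edges (q, 0) \<union> hex_edges (q + 1, 0). (q, q + 1) \<in> f} =
      {{(q, q + 1), (q - 1, q + 1)}, {(q, q + 1), (q, q + 2)}, {(q, q + 1), (q + 1, q)}}" (is ?Z1)
    and "hex_verts (q + 1, -1) = {(q + 1, q - 1), (q + 2, q), (q + 1, q)} \<union>
      set [(q + 2, q - 2), (q + 3, q - 2), (q + 3, q - 1)]" (is ?V2)
    and "hex_edges (q + 1, -1) = {{(q + 1, q), (q + 1, q - 1)}, {(q + 1, q), (q + 2, q)}} \<union>
      path_edges ((q + 1, q - 1) # [(q + 2, q - 2), (q + 3, q - 2), (q + 3, q - 1)] @ [(q + 2, q)])" (is ?E2)
    and "{f \<in> hex_edges (q, 0) \<union> hex_edges (q + 1, 0). (q + 1, q) \<in> f} =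
      {{(q + 1, q), (q + 1, q - 1)}, {(q + 1, q), (q + 2, q)}, {(q + 1, q), (q, q + 1)}}" (is ?Z2)
proof -
  note sums = add.commute[of 1 q] add.commute[of 2 q] add.commute[of 3 q]
  show ?V1 ?V2 by (simp_all add: hex_verts_eq sums insert_commute)
  show ?E1 ?E2 by (simp_all add: hex_edges_eq sums insert_commute)
  have *: "{f \<in> {}. p \<in> f} = {}" "{f \<in> insert e F. p \<in> f} = (if p \<in> e then insert e {f \<in> F. p \<in> f} else {f \<in> F. p \<in> f})"
    for p e and F :: "point set set" by auto
  show ?Z1 ?Z2
    unfolding hex_edges_eq Un_insert_left Un_empty_left *
    by (simp_all add: sums insert_commute)
qed

text \<open>The hexagon \<open>w\<close> is attached to \<open>u\<close> along \<open>e0\<close>. Then \<open>a\<close> and \<open>b\<close> fill the corners at the two ends of \<open>e0\<close>;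
\<open>e1\<close> and \<open>e2\<close> are the edges of \<open>a\<close> in \<open>u\<close> and \<open>w\<close>, and \<open>d1\<close> and \<open>d2\<close> those of \<open>b\<close>. The formula for \<open>b\<close> calls
for the graph with \<open>a\<close> and one of \<open>d1\<close>, \<open>d2\<close>, \<open>e0\<close> deleted, that for \<open>a\<close> for up to one further deletion
among \<open>e1\<close>, \<open>e2\<close>, \<open>e0\<close>. So the values for \<open>u\<close> and \<open>w\<close> alone are tabulated first. In that table a count is
zero as soon as two edges are deleted that only \<open>u\<close> has, or two that only \<open>w\<close> has.\<close>

lemma pyrene_unit:
  fixes q :: int
  defines "u \<equiv> (q, 0)" and "w \<equiv> (q + 1, 0)" and "a \<equiv> (q, 1)" and "b \<equiv> (q + 1, -1)"
  assumes u: "end_hexagon K u x y" and new: "w \<notin> K" "a \<notin> K" "b \<notin> K"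
    and nbr: "\<And>k. k \<in> K \<Longrightarrow> adjacent w k \<Longrightarrow> k = u" "\<And>k. k \<in> K \<Longrightarrow> adjacent a k \<Longrightarrow> k = u"
      "\<And>k. k \<in> K \<Longrightarrow> adjacent b k \<Longrightarrow> k = u"
  shows "trees_without (insert b (insert a (insert w K))) {} = 204 * x - 132 * y"
    and "g \<in> hex_edges w \<Longrightarrow> g \<notin> hex_edges u \<Longrightarrow> g \<notin> hex_edges a \<Longrightarrow> g \<notin> hex_edges b \<Longrightarrow>
      trees_without (insert b (insert a (insert w K))) {g} = 36 * x - 12 * y"
proof -
  let ?W = "insert w K"
  let ?A = "insert a ?W"
  let ?B = "insert b ?A"
  let ?t = trees_without
  note fin = end_hexagonD(1)[OF u] and uK = end_hexagonD(2)[OF u]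
  note sums = add.commute[of 1 q] add.commute[of 2 q] add.commute[of 3 q]
  define z z' xa ya xb yb where "z = (q, q + 1)" and "z' = (q + 1, q)"
    and "xa = (q - 1, q + 1)" and "ya = (q, q + 2)" and "xb = (q + 1, q - 1)" and "yb = (q + 2, q)"
  note pts = z_def z'_def xa_def ya_def xb_def yb_def
  note cells = u_def w_def a_def b_def
  define e0 e1 e2 d1 d2 where "e0 = {z, z'}" and "e1 = {z, xa}" and "e2 = {z, ya}"
    and "d1 = {z', xb}" and "d2 = {z', yb}"
  note eds = e0_def e1_def e2_def d1_def d2_def
  have ne: "e0 \<noteq> e1" "e0 \<noteq> e2" "e0 \<noteq> d1" "e0 \<noteq> d2" "e1 \<noteq> e2" "e1 \<noteq> d1" "e1 \<noteq> d2"
    "e2 \<noteq> d1" "e2 \<noteq> d2" "d1 \<noteq> d2"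
    unfolding eds pts by (auto simp: doubleton_eq_iff)
  have in_u: "e0 \<in> hex_edges u" "e1 \<in> hex_edges u" "d1 \<in> hex_edges u"
    unfolding eds pts cells hex_edges_eq by (simp_all add: sums insert_commute)
  have in_w: "e0 \<in> hex_edges w" "e2 \<in> hex_edges w" "d2 \<in> hex_edges w"
    unfolding eds pts cells hex_edges_eq by (simp_all add: sums insert_commute)
  have in_a: "e1 \<in> hex_edges a" "e2 \<in> hex_edges a"
    unfolding eds pts cells hex_edges_eq by (simp_all add: sums insert_commute)
  have in_b: "d1 \<in> hex_edges b" "d2 \<in> hex_edges b"
    unfolding eds pts cells hex_edges_eq by (simp_all add: sums insert_commute)
  have cells_ne: "u \<noteq> w" "u \<noteq> a" "u \<noteq> b" "w \<noteq> a" "w \<noteq> b" "a \<noteq> b" unfolding cells by auto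
  note cells_ne = cells_ne cells_ne[symmetric]
  have not_u: "e2 \<notin> hex_edges u" "d2 \<notin> hex_edges u"
    using shared_edge_unique[OF cells_ne(1) in_u(1) in_w(1)] in_w ne by metis+
  have not_w: "e1 \<notin> hex_edges w" "d1 \<notin> hex_edges w"
    using shared_edge_unique[OF cells_ne(1) in_u(1) in_w(1)] in_u ne by metis+
  have not_a: "e0 \<notin> hex_edges a" "d1 \<notin> hex_edges a" "d2 \<notin> hex_edges a"
    using shared_edge_unique[OF cells_ne(2) in_u(2) in_a(1)] shared_edge_unique[OF cells_ne(4) in_w(2) in_a(2)]
      in_u in_w ne by metis+
  have not_b: "e0 \<notin> hex_edges b" "e1 \<notin> hex_edges b" "e2 \<notin> hex_edges b"
    using shared_edge_unique[OF cells_ne(3) in_u(3) in_b(1)] shared_edge_unique[OF cells_ne(5) in_w(3) in_b(2)]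
      in_u in_w ne by metis+
  have rim: "e \<notin> bz_edges (K - {u})" if e: "e \<in> {e0, e1, d1}" for e
  proof -
    consider "e \<in> hex_edges w" | "e \<in> hex_edges a" | "e \<in> hex_edges b"
      using e in_w in_a in_b by blast
    then show ?thesis
    proof cases
      case 1
      then show ?thesis
      proof (rule edge_notin_bz_edges)
        show "\<not> adjacent w k" if "k \<in> K - {u}" for k using nbr(1)[of k] that by blast
      qed (use new in blast)
    next
      case 2
      then show ?thesis
      proof (rule edge_notin_bz_edges)
        show "\<not> adjacent a k" if "k \<in> K - {u}" for k using nbr(2)[of k] that by blast
      qed (use new in blast)
    next
      case 3
      then show ?thesis
      proof (rule edge_notin_bz_edges)
        show "\<not> adjacent b k" if "k \<in> K - {u}" for k using nbr(3)[of k] that by blast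
      qed (use new in blast)
    qed
  qed
  have in_u': "e \<in> hex_edges u" if "e \<in> {e0, e1, d1}" for e using that in_u by auto
  have U0: "?t K {} = x" by (rule end_hexagonD(3)[OF u])
  have U1: "?t K {e0} = y" "?t K {e1} = y" "?t K {d1} = y"
    by (rule end_hexagonD(4)[OF u in_u' rim]; simp)+
  have U2: "?t K D = 0" if "e \<in> {e0, e1, d1}" "e' \<in> {e0, e1, d1}" "e \<noteq> e'" "e \<in> D" "e' \<in> D" for e e' D
    using that in_u' rim by (intro end_hexagonD(5)[OF u, of e e'])
  have U2': "?t K (insert e0 (insert e1 D)) = 0" "?t K (insert e0 (insert d1 D)) = 0"
      "?t K (insert e1 (insert d1 D)) = 0" "?t K (insert e1 (insert e0 D)) = 0" for D
    using ne by (intro U2[of e0 e1] U2[of e0 d1] U2[of e1 d1]; simp)+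
  note attach_w = attach_hexagon[OF fin uK new(1) nbr(1) in_w(1) in_u(1)]
  \<comment> \<open>The table for \<open>u\<close> and \<open>w\<close>: first no edge of \<open>w\<close> deleted, then \<open>e0\<close>, then an edge that only \<open>w\<close> has.\<close>
  have W0: "?t ?W {} = 6 * x - y" "?t ?W {e1} = 6 * y" "?t ?W {d1} = 6 * y" "?t ?W {e1, d1} = 0"
    using attach_w(1)[of "{}"] attach_w(1)[of "{e1}"] attach_w(1)[of "{d1}"] attach_w(1)[of "{e1, d1}"]
    by (simp_all add: not_w U0 U1 U2')
  have We0: "?t ?W {e0} = 4 * y + x" "?t ?W {e1, e0} = y" "?t ?W {e0, d1} = y"
    using attach_w(2)[of "{}"] attach_w(2)[of "{e1}"] attach_w(2)[of "{d1}"]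
    by (simp_all add: not_w U0 U1 U2' insert_commute[of e1 e0])
  have W1: "?t ?W (insert f D) = ?t K D" if "f \<in> hex_edges w" "f \<noteq> e0" "D \<subseteq> {e0, e1, d1}" for f D
    using that not_w by (intro attach_w(3)) auto
  have W2: "?t ?W D = 0"
    if "f \<in> hex_edges w" "f' \<in> hex_edges w" "f \<noteq> e0" "f' \<noteq> e0" "f \<noteq> f'" "f \<in> D" "f' \<in> D" for f f' D
    using that by (intro attach_w(4)[where f = f and f' = f']) auto
  have one: "?t ?W {f} = x" "?t ?W {e1, f} = y" "?t ?W {f, d1} = y" "?t ?W {d1, f} = y" "?t ?W {e0, f} = y"
    "?t ?W {e1, d1, f} = 0" "?t ?W {e0, d1, f} = 0" "?t ?W {e1, e0, f} = 0"
    if f: "f \<in> hex_edges w" "f \<noteq> e0" for f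
  proof -
    note W1' = W1[OF f]
    show "?t ?W {f} = x" using W1'[of "{}"] by (simp add: U0)
    show "?t ?W {e1, f} = y" using W1'[of "{e1}"] by (simp add: U1 insert_commute)
    show "?t ?W {f, d1} = y" using W1'[of "{d1}"] by (simp add: U1)
    then show "?t ?W {d1, f} = y" by (simp add: insert_commute)
    show "?t ?W {e0, f} = y" using W1'[of "{e0}"] by (simp add: U1 insert_commute)
    have "?t ?W (insert f {e1, d1}) = 0" using W1'[of "{e1, d1}"] by (simp add: U2')
    then show "?t ?W {e1, d1, f} = 0" by (simp add: insert_commute)
    have "?t ?W (insert f {e0, d1}) = 0" using W1'[of "{e0, d1}"] by (simp add: U2')
    then show "?t ?W {e0, d1, f} = 0" by (simp add: insert_commute)
    have "?t ?W (insert f {e1, e0}) = 0" using W1'[of "{e1, e0}"] by (simp add: U2')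
    then show "?t ?W {e1, e0, f} = 0" by (simp add: insert_commute)
  qed
  have e2: "e2 \<in> hex_edges w" "e2 \<noteq> e0" and d2: "d2 \<in> hex_edges w" "d2 \<noteq> e0" using in_w ne by auto
  have A: "D \<inter> hex_edges a = {} \<Longrightarrow> e0 \<notin> D \<Longrightarrow> ?t ?A D = 6 * ?t ?W D
      - 2 * ?t ?W (insert e1 D) - 2 * ?t ?W (insert e2 D) + ?t ?W (insert e0 D)"
    "D \<inter> hex_edges a = {} \<Longrightarrow> e0 \<in> D \<Longrightarrow> ?t ?A D = 6 * ?t ?W D - 4 * ?t ?W (insert e1 D)" for D
  proof -
    have nbr_a: "k = u \<or> k = w" if "k \<in> ?W" "adjacent a k" for k using that nbr(2) by blast
    have "hex_verts a \<inter> hex_verts u = e1" "hex_verts a \<inter> hex_verts w = e2"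
      using cells_ne in_u in_w in_a by (intro hex_verts_Int_adjacent; simp)+
    then have V: "hex_verts a \<inter> (hex_verts u \<union> hex_verts w) = {xa, ya, z}"
      unfolding Int_Un_distrib e1_def e2_def by auto
    let ?ps = "[(q - 2, q + 2), (q - 2, q + 3), (q - 1, q + 3)]"
    have d: "distinct [xa, ya, z', z]" "distinct ?ps" "set ?ps \<inter> {xa, ya, z} = {}" "length ?ps = 3"
      unfolding pts by auto
    have u': "u \<in> ?W" "w \<in> ?W" "a \<notin> ?W" "finite ?W" using uK new cells_ne fin by auto
    have shape: "hex_verts a = {xa, ya, z} \<union> set ?ps"
      "hex_edges a = {{z, xa}, {z, ya}} \<union> path_edges (xa # ?ps @ [ya])"
      "{f \<in> hex_edges u \<union> hex_edges w. z \<in> f} = {{z, xa}, {z, ya}, {z, z'}}"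
      unfolding pts cells by (fact pyrene_corners)+
    note corner = attach_in_corner[OF u'(4,1,2,3) _ d shape(1) V shape(2,3)]
    show "D \<inter> hex_edges a = {} \<Longrightarrow> e0 \<notin> D \<Longrightarrow> ?t ?A D = 6 * ?t ?W D
        - 2 * ?t ?W (insert e1 D) - 2 * ?t ?W (insert e2 D) + ?t ?W (insert e0 D)"
      "D \<inter> hex_edges a = {} \<Longrightarrow> e0 \<in> D \<Longrightarrow> ?t ?A D = 6 * ?t ?W D - 4 * ?t ?W (insert e1 D)"
      unfolding eds by (intro corner nbr_a; assumption)+
  qed
  have B: "D \<inter> hex_edges b = {} \<Longrightarrow> e0 \<notin> D \<Longrightarrow> ?t ?B D = 6 * ?t ?A D
      - 2 * ?t ?A (insert d1 D) - 2 * ?t ?A (insert d2 D) + ?t ?A (insert e0 D)" for D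
  proof -
    have "\<not> adjacent b a" unfolding cells adjacent_iff by simp
    then have nbr_b: "k = u \<or> k = w" if "k \<in> ?A" "adjacent b k" for k using that nbr(3) by blast
    have "hex_verts b \<inter> hex_verts u = d1" "hex_verts b \<inter> hex_verts w = d2"
      using cells_ne in_u in_w in_b by (intro hex_verts_Int_adjacent; simp)+
    then have V: "hex_verts b \<inter> (hex_verts u \<union> hex_verts w) = {xb, yb, z'}"
      unfolding Int_Un_distrib d1_def d2_def by auto
    let ?ps = "[(q + 2, q - 2), (q + 3, q - 2), (q + 3, q - 1)]"
    have d: "distinct [xb, yb, z, z']" "distinct ?ps" "set ?ps \<inter> {xb, yb, z'} = {}" "length ?ps = 3"
      unfolding pts by auto
    have u': "u \<in> ?A" "w \<in> ?A" "b \<notin> ?A" "finite ?A" using uK new cells_ne fin by auto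
    have shape: "hex_verts b = {xb, yb, z'} \<union> set ?ps"
      "hex_edges b = {{z', xb}, {z', yb}} \<union> path_edges (xb # ?ps @ [yb])"
      "{f \<in> hex_edges u \<union> hex_edges w. z' \<in> f} = {{z', xb}, {z', yb}, {z', z}}"
      unfolding pts cells by (fact pyrene_corners)+
    note corner = attach_in_corner(1)[OF u'(4,1,2,3) _ d shape(1) V shape(2,3)]
    have e0': "e0 = {z', z}" unfolding e0_def by (rule insert_commute)
    show "D \<inter> hex_edges b = {} \<Longrightarrow> e0 \<notin> D \<Longrightarrow> ?t ?B D = 6 * ?t ?A D
      - 2 * ?t ?A (insert d1 D) - 2 * ?t ?A (insert d2 D) + ?t ?A (insert e0 D)"
      unfolding e0' d1_def d2_def by (intro corner nbr_b; assumption)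
  qed
  have A0: "?t ?A {} = 35 * x - 14 * y" "?t ?A {d1} = 35 * y" "?t ?A {d2} = 6 * x - y"
      "?t ?A {e0} = 6 * x + 20 * y"
    using A(1)[of "{}"] A(1)[of "{d1}"] A(1)[of "{d2}"] A(2)[of "{e0}"] ne not_a
      W2[of e2 d2 "{e2, d2}"] e2 d2
    by (simp_all add: W0 We0 one[OF e2] one[OF d2])
  show "?t ?B {} = 204 * x - 132 * y"
    using B[of "{}"] by (simp add: A0)
  show "?t ?B {g} = 36 * x - 12 * y"
    if g: "g \<in> hex_edges w" "g \<notin> hex_edges u" "g \<notin> hex_edges a" "g \<notin> hex_edges b"
  proof -
    have g0: "g \<noteq> e0" "g \<noteq> e2" "g \<noteq> d2" using g in_u in_a in_b by auto
    note g1 = one[OF g(1) g0(1)]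
    have W3: "?t ?W (insert e (insert g D)) = 0" "?t ?W (insert e' (insert e (insert g D))) = 0"
      if "e \<in> {e2, d2}" for e e' D
      using that g(1) g0 e2 d2 by (intro W2[of e g]; auto)+
    have "?t ?A {g} = 6 * x - y"
      using A(1)[of "{g}"] g g0 by (simp add: g1 W3)
    moreover have "?t ?W {e2, d1, g} = 0"
      using g(1) g0 e2 by (intro W2[of e2 g]) auto
    then have "?t ?A {d1, g} = 6 * y"
      using A(1)[of "{d1, g}"] g g0 ne not_a by (simp add: g1)
    moreover have "?t ?A {d2, g} = 0"
      using A(1)[of "{d2, g}"] g g0 ne not_a by (simp add: g1 W3)
    moreover have "?t ?A {e0, g} = 6 * y"
      using A(2)[of "{e0, g}"] g g0 ne not_a by (simp add: g1)
    ultimately show ?thesis using B[of "{g}"] g g0 by simp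
  qed
qed

text \<open>The chain is built unit by unit; \<open>w\<close> of one unit is the only earlier neighbour of \<open>u\<close> of the next.\<close>

lemma pyrene_chain_count:
  assumes "n \<ge> 1"
  shows "trees_without (pyrene_chain n) {} = fst (iterate_unit 1092 204 204 36 n)"
proof -
  define X where "X = iterate_unit 1092 204 204 36"
  define Z where "Z k = insert (pyr_u (Suc k)) (pyrene_chain k)" for k
  note defs = pyr_u_def pyr_w_def pyr_a_def pyr_b_def
  have chain_cases: "\<exists>i\<le>k. h \<in> {pyr_u i, pyr_w i, pyr_a i, pyr_b i}" if "h \<in> pyrene_chain k" for h k
    using that unfolding pyrene_chain_def by auto
  have chain_Suc: "pyrene_chain (Suc k) =
      insert (pyr_b (Suc k)) (insert (pyr_a (Suc k)) (insert (pyr_w (Suc k)) (Z k)))" for k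
  proof -
    have "{1..Suc k} = insert (Suc k) {1..k}" by auto
    then show ?thesis unfolding pyrene_chain_def Z_def by auto
  qed
  have same: "pyr_u i = pyr_u j \<longleftrightarrow> i = j" "pyr_w i = pyr_w j \<longleftrightarrow> i = j"
    "pyr_a i = pyr_a j \<longleftrightarrow> i = j" "pyr_b i = pyr_b j \<longleftrightarrow> i = j" for i j
    by (auto simp: defs)
  have distinct: "pyr_u i \<noteq> pyr_w j" "pyr_w i \<noteq> pyr_u j" "pyr_u i \<noteq> pyr_a j" "pyr_a i \<noteq> pyr_u j"
    "pyr_u i \<noteq> pyr_b j" "pyr_b i \<noteq> pyr_u j" "pyr_w i \<noteq> pyr_a j" "pyr_a i \<noteq> pyr_w j"
    "pyr_w i \<noteq> pyr_b j" "pyr_b i \<noteq> pyr_w j" "pyr_a i \<noteq> pyr_b j" "pyr_b i \<noteq> pyr_a j" for i j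
    unfolding defs prod.inject by presburger+
  have fresh: "pyr_u i \<notin> pyrene_chain k" "pyr_w i \<notin> pyrene_chain k"
    "pyr_a i \<notin> pyrene_chain k" "pyr_b i \<notin> pyrene_chain k" if "k < i" for i k
    using that unfolding pyrene_chain_def by (auto simp: same distinct)
  have unit: "trees_without (pyrene_chain (Suc k)) {} = fst (X (Suc k))"
    "\<And>g. g \<in> hex_edges (pyr_w (Suc k)) \<Longrightarrow> g \<notin> hex_edges (pyr_u (Suc k)) \<Longrightarrow>
      g \<notin> hex_edges (pyr_a (Suc k)) \<Longrightarrow> g \<notin> hex_edges (pyr_b (Suc k)) \<Longrightarrow>
      trees_without (pyrene_chain (Suc k)) {g} = snd (X (Suc k))"
    if Z: "end_hexagon (Z k) (pyr_u (Suc k)) (6 * fst (X k) - snd (X k)) (fst (X k))" for k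
  proof -
    let ?m = "Suc k"
    let ?q = "2 * int ?m"
    have cells: "pyr_u ?m = (?q, 0)" "pyr_w ?m = (?q + 1, 0)" "pyr_a ?m = (?q, 1)" "pyr_b ?m = (?q + 1, -1)"
      by (simp_all add: defs)
    have new: "pyr_w ?m \<notin> Z k" "pyr_a ?m \<notin> Z k" "pyr_b ?m \<notin> Z k"
      using fresh[of k ?m] unfolding Z_def by (auto simp: defs)
    have nbr: "h = pyr_u ?m" if h: "h \<in> Z k"
      and adj: "adjacent (pyr_w ?m) h \<or> adjacent (pyr_a ?m) h \<or> adjacent (pyr_b ?m) h" for h
    proof (rule ccontr)
      assume "h \<noteq> pyr_u ?m"
      then obtain i where "i \<le> k" "h \<in> {pyr_u i, pyr_w i, pyr_a i, pyr_b i}"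
        using h chain_cases unfolding Z_def by blast
      then show False using adj by (auto simp: pyr_adjacent)
    qed
    note unit' = pyrene_unit[where q = ?q, folded cells, OF Z new]
    show "trees_without (pyrene_chain ?m) {} = fst (X ?m)"
      unfolding chain_Suc using nbr by (subst unit'(1)) (auto simp: X_def case_prod_beta Let_def)
    show "trees_without (pyrene_chain ?m) {g} = snd (X ?m)"
      if "g \<in> hex_edges (pyr_w ?m)" "g \<notin> hex_edges (pyr_u ?m)"
        "g \<notin> hex_edges (pyr_a ?m)" "g \<notin> hex_edges (pyr_b ?m)" for g
      unfolding chain_Suc using nbr that by (subst unit'(2)) (auto simp: X_def case_prod_beta Let_def)
  qed
  have Z: "end_hexagon (Z k) (pyr_u (Suc k)) (6 * fst (X k) - snd (X k)) (fst (X k))" for k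
  proof (induction k)
    case 0
    have "pyrene_chain 0 = {}" by (simp add: pyrene_chain_def)
    then show ?case using end_hexagon_single by (simp add: Z_def X_def)
  next
    case (Suc k)
    let ?m = "Suc k"
    have mem: "pyr_w ?m \<in> pyrene_chain ?m" unfolding chain_Suc by simp
    have only: "h = pyr_w ?m" if h: "h \<in> pyrene_chain ?m" "adjacent (pyr_u (Suc ?m)) h" for h
    proof -
      obtain i where "i \<le> ?m" "h \<in> {pyr_u i, pyr_w i, pyr_a i, pyr_b i}"
        using chain_cases[OF h(1)] by blast
      then show ?thesis using h(2) by (auto simp: pyr_adjacent)
    qed
    have "adjacent (pyr_u (Suc ?m)) (pyr_w ?m)" by (simp add: pyr_adjacent)
    then obtain e where e: "e \<in> hex_edges (pyr_u (Suc ?m))" "e \<in> hex_edges (pyr_w ?m)"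
      by (rule adjacent_obtain_edge)
    have far: "e \<notin> hex_edges h" if "\<not> adjacent (pyr_u (Suc ?m)) h" "h \<noteq> pyr_u (Suc ?m)" for h
      using that e(1) unfolding adjacent_def by blast
    have "e \<notin> hex_edges (pyr_u ?m)" "e \<notin> hex_edges (pyr_a ?m)" "e \<notin> hex_edges (pyr_b ?m)"
      by (rule far; simp add: pyr_adjacent same distinct)+
    then have "trees_without (pyrene_chain ?m) {e} = snd (X ?m)" using unit(2)[OF Suc e(2)] by simp
    then show ?case
      using end_hexagon_attach[OF finite_pyrene_chain mem fresh(1) only e] unit(1)[OF Suc]
      unfolding Z_def by simp
  qed
  obtain k where "n = Suc k" using assms by (cases n) auto
  then show ?thesis using unit(1)[OF Z] by (simp add: X_def)
qed

section \<open>The spanning tree counts\<close>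

theorem corollary4p6:
  fixes n :: nat
  assumes "n \<ge> 1"
  shows "real (num_spanning_trees (pyrene_chain n)) =
           (240 + 47 * sqrt 30) / 480 * (528 + 96 * sqrt 30) ^ n +
           (240 - 47 * sqrt 30) / 480 * (528 - 96 * sqrt 30) ^ n \<and>
         (\<forall>T. triphenylene_chain n T \<longrightarrow>
           real (num_spanning_trees T) =
             (1329265 + 1223 * sqrt 1329265) / 2658530 * ((1153 + sqrt 1329265) / 2) ^ n +
             (1329265 - 1223 * sqrt 1329265) / 2658530 * ((1153 - sqrt 1329265) / 2) ^ n)"
proof (intro conjI allI impI)
  let ?s = "sqrt 30"
  have s: "?s * ?s = 30" by simp
  have "real (num_spanning_trees (pyrene_chain n)) = real_of_int (trees_without (pyrene_chain n) {})"
    unfolding num_spanning_trees_eq[OF finite_pyrene_chain, symmetric] by simp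
  also have "\<dots> = (240 + 47 * ?s) / 480 * (528 + 96 * ?s) ^ n + (240 - 47 * ?s) / 480 * (528 - 96 * ?s) ^ n"
    unfolding pyrene_chain_count[OF assms]
    \<comment> \<open>The second entry is \<open>204\<close> after one step, so \<open>\<gamma>\<close> is \<open>204\<close> divided by the difference \<open>192 * sqrt 30\<close> of the eigenvalues.\<close>
    by (rule iterate_unit_closed_form[where \<gamma> = "17 * ?s / 480"]) (simp_all add: field_simps s)
  finally show "real (num_spanning_trees (pyrene_chain n)) =
      (240 + 47 * ?s) / 480 * (528 + 96 * ?s) ^ n + (240 - 47 * ?s) / 480 * (528 - 96 * ?s) ^ n" .
next
  fix T assume T: "triphenylene_chain n T"
  let ?s = "sqrt 1329265"
  have s: "?s * ?s = 1329265" by simp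
  have "finite T" using T by (auto simp: triphenylene_chain_def benzenoid_def)
  then have "real (num_spanning_trees T) = real_of_int (trees_without T {})"
    by (simp flip: num_spanning_trees_eq)
  also have "\<dots> = (1329265 + 1223 * ?s) / 2658530 * ((1153 + ?s) / 2) ^ n +
      (1329265 - 1223 * ?s) / 2658530 * ((1153 - ?s) / 2) ^ n"
    unfolding triphenylene_chain_count[OF assms T]
    \<comment> \<open>Again \<open>\<gamma>\<close> is \<open>204\<close> divided by the difference of the eigenvalues, which is \<open>sqrt 1329265\<close>.\<close>
    by (rule iterate_unit_closed_form[where \<gamma> = "204 * ?s / 1329265"]) (simp_all add: field_simps s)
  finally show "real (num_spanning_trees T) = (1329265 + 1223 * ?s) / 2658530 * ((1153 + ?s) / 2) ^ n +
      (1329265 - 1223 * ?s) / 2658530 * ((1153 - ?s) / 2) ^ n" .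
qed

end
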